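(* Let $k\ge0$. For all formulas $\varphi\in\mathcal{V}_{k+1}$ and $\psi\in\mathcal{Q}_{k+1}$ of the language of $\mathsf{HA}$, if $\mathsf{PA}\vdash\psi\to\varphi$, then $\mathsf{HA}+\mathrm{LEM}(\Sigma_k)\vdash\psi\to\varphi$.
   Context: $\mathsf{HA}$ is intuitionistic first-order arithmetic with function symbols for all primitive recursive functions and logical constants $\forall,\exists,\to,\land,\lor,\perp$ ($\neg\varphi:\equiv\varphi\to\perp$); $\mathsf{PA}$ is $\mathsf{HA}$ plus the law of excluded middle for all formulas. $\Sigma_0=\Pi_0$ is the class of quantifier-free formulas; $\Sigma_{k+1}$ consists of formulas $\exists x_1\cdots\exists x_n\varphi$ with $\varphi\in\Pi_k$, $\Pi_{k+1}$ of formulas $\forall x_1\cdots\forall x_n\varphi$ with $\varphi\in\Sigma_k$. $\mathrm{LEM}(\Sigma_k)$ is the scheme $\varphi\lor\neg\varphi$, $\varphi\in\Sigma_k$ (free variables allowed). Degree: an alternation path is a finite sequence of symbols $+,-$ in which they alternate; for a path $s$, $i(s)$ is its first symbol if $s$ is nonempty and a third symbol $\times$ if $s$ is empty, $s^\perp$ swaps $+$ and $-$, $l(s)$ is its length. The set $\mathrm{Alt}(\varphi)$: if $\varphi$ is quantifier-free, $\mathrm{Alt}(\varphi)=\{\langle\rangle\}$; otherwise $\mathrm{Alt}(\varphi_1\land\varphi_2)=\mathrm{Alt}(\varphi_1\lor\varphi_2)=\mathrm{Alt}(\varphi_1)\cup\mathrm{Alt}(\varphi_2)$, $\mathrm{Alt}(\varphi_1\to\varphi_2)=\{s^\perp:s\in\mathrm{Alt}(\varphi_1)\}\cup\mathrm{Alt}(\varphi_2)$,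 $\mathrm{Alt}(\forall x\varphi_1)=\{s\in\mathrm{Alt}(\varphi_1):i(s)=-\}\cup\{-s:s\in\mathrm{Alt}(\varphi_1),i(s)\ne-\}$, $\mathrm{Alt}(\exists x\varphi_1)=\{s\in\mathrm{Alt}(\varphi_1):i(s)=+\}\cup\{+s:s\in\mathrm{Alt}(\varphi_1),i(s)\ne+\}$. $\deg(\varphi)=\max\{l(s):s\in\mathrm{Alt}(\varphi)\}$. $\mathrm{F}_k^+$ is the class of formulas of degree $\le k$. Classes: $\mathcal{R}_0=\mathcal{J}_0=\Sigma_0$. $\mathcal{R}_{k+1},\mathcal{J}_{k+1}$ are simultaneously inductively generated by: every $F\in\mathrm{F}_k^+$ is in both; if $R,R'\in\mathcal{R}_{k+1}$, $J,J'\in\mathcal{J}_{k+1}$, then $R\land R',R\lor R',\forall xR,J\to R\in\mathcal{R}_{k+1}$ and $J\land J',J\lor J',\exists xJ,R\to J\in\mathcal{J}_{k+1}$. $\mathcal{Q}_0=\Sigma_0$; $\mathcal{Q}_{k+1}$ is generated by: prime formulas are in it, and if $Q,Q'\in\mathcal{Q}_{k+1}$, $J\in\mathcal{J}_{k+1}$ then $Q\land Q',Q\lor Q',\forall xQ,\exists xQ,J\to Q\in\mathcal{Q}_{k+1}$. $\mathcal{V}_{k+1}$ is generated by: $\mathcal{J}_{k+1}\subseteq\mathcal{V}_{k+1}$, and if $V,V'\in\mathcal{V}_{k+1}$ then $V\land V',\forall xV\in\mathcal{V}_{k+1}$. *)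

theory Defs
  imports Main
begin

section \<open>The language of HA\<close>

text \<open>Function symbols are definitions of primitive recursive functions. \<open>Comp n f gs\<close> carries
  its arity explicitly because \<open>gs\<close> may be empty; \<open>Rec g h\<close> recurses on its first argument.\<close>

datatype prfun =
    ZeroF
  | SuccF
  | Proj nat nat
  | Comp nat prfun "prfun list"
  | Rec prfun prfun

fun has_arity :: "prfun \<Rightarrow> nat \<Rightarrow> bool" where
  "has_arity ZeroF n \<longleftrightarrow> n = 0"
| "has_arity SuccF n \<longleftrightarrow> n = 1"
| "has_arity (Proj m i) n \<longleftrightarrow> n = m \<and> i < m"
| "has_arity (Comp m f gs) n \<longleftrightarrow>
     n = m \<and> has_arity f (length gs) \<and> (\<forall>g \<in> set gs. has_arity g m)"
| "has_arity (Rec g h) n \<longleftrightarrow>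
     (\<exists>m. n = Suc m \<and> has_arity g m \<and> has_arity h (Suc (Suc m)))"

datatype tm = Var nat | Fn prfun "tm list"

text \<open>Variables are de Bruijn indices.\<close>

datatype fm =
    Eq tm tm
  | Bot
  | And fm fm
  | Or fm fm
  | Imp fm fm
  | All fm
  | Ex fm

abbreviation Neg :: "fm \<Rightarrow> fm" where
  "Neg \<phi> \<equiv> Imp \<phi> Bot"

abbreviation Zero :: tm where
  "Zero \<equiv> Fn ZeroF []"

abbreviation Succ :: "tm \<Rightarrow> tm" where
  "Succ t \<equiv> Fn SuccF [t]"

text \<open>The formulas of the language are the elements of \<^typ>\<open>fm\<close> in which every function symbol is
  well-formed and applied to the right number of arguments.\<close>

fun wf_tm :: "tm \<Rightarrow> bool" where
  "wf_tm (Var n) \<longleftrightarrow> True"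
| "wf_tm (Fn f ts) \<longleftrightarrow> has_arity f (length ts) \<and> (\<forall>t \<in> set ts. wf_tm t)"

fun wf_fm :: "fm \<Rightarrow> bool" where
  "wf_fm (Eq s t) \<longleftrightarrow> wf_tm s \<and> wf_tm t"
| "wf_fm Bot \<longleftrightarrow> True"
| "wf_fm (And \<phi> \<psi>) \<longleftrightarrow> wf_fm \<phi> \<and> wf_fm \<psi>"
| "wf_fm (Or \<phi> \<psi>) \<longleftrightarrow> wf_fm \<phi> \<and> wf_fm \<psi>"
| "wf_fm (Imp \<phi> \<psi>) \<longleftrightarrow> wf_fm \<phi> \<and> wf_fm \<psi>"
| "wf_fm (All \<phi>) \<longleftrightarrow> wf_fm \<phi>"
| "wf_fm (Ex \<phi>) \<longleftrightarrow> wf_fm \<phi>"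

fun subst_tm :: "(nat \<Rightarrow> tm) \<Rightarrow> tm \<Rightarrow> tm" where
  "subst_tm \<sigma> (Var n) = \<sigma> n"
| "subst_tm \<sigma> (Fn f ts) = Fn f (map (subst_tm \<sigma>) ts)"

definition under_binder :: "(nat \<Rightarrow> tm) \<Rightarrow> nat \<Rightarrow> tm" where
  "under_binder \<sigma> = case_nat (Var 0) (\<lambda>n. subst_tm (\<lambda>m. Var (Suc m)) (\<sigma> n))"

fun subst :: "(nat \<Rightarrow> tm) \<Rightarrow> fm \<Rightarrow> fm" where
  "subst \<sigma> (Eq s t) = Eq (subst_tm \<sigma> s) (subst_tm \<sigma> t)"
| "subst \<sigma> Bot = Bot"
| "subst \<sigma> (And \<phi> \<psi>) = And (subst \<sigma> \<phi>) (subst \<sigma> \<psi>)"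
| "subst \<sigma> (Or \<phi> \<psi>) = Or (subst \<sigma> \<phi>) (subst \<sigma> \<psi>)"
| "subst \<sigma> (Imp \<phi> \<psi>) = Imp (subst \<sigma> \<phi>) (subst \<sigma> \<psi>)"
| "subst \<sigma> (All \<phi>) = All (subst (under_binder \<sigma>) \<phi>)"
| "subst \<sigma> (Ex \<phi>) = Ex (subst (under_binder \<sigma>) \<phi>)"

definition lift :: "fm \<Rightarrow> fm" where
  "lift = subst (\<lambda>n. Var (Suc n))"

definition inst :: "tm \<Rightarrow> fm \<Rightarrow> fm" where
  "inst t = subst (case_nat t Var)"

text \<open>\<open>subst_Succ \<phi>\<close> is \<open>\<phi>(S x)\<close> when the variable with index 0 stands for \<open>x\<close>.\<close>

definition subst_Succ :: "fm \<Rightarrow> fm" where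
  "subst_Succ = subst (case_nat (Succ (Var 0)) (\<lambda>n. Var (Suc n)))"


section \<open>Derivability\<close>

text \<open>Intuitionistic natural deduction with equality over a set \<open>T\<close> of axioms, from hypotheses
  \<open>\<Gamma>\<close>. Free variables of axioms are read universally, so the eigenvariable conditions, expressed
  by \<^const>\<open>lift\<close>, concern \<open>\<Gamma>\<close> only. The well-formedness premises confine derivations to formulas
  of the language; in particular, members of \<open>T\<close> that are not well-formed are never used.\<close>

inductive derives :: "fm set \<Rightarrow> fm set \<Rightarrow> fm \<Rightarrow> bool" for T :: "fm set" where
  axiom: "\<lbrakk>\<phi> \<in> T; wf_fm \<phi>\<rbrakk> \<Longrightarrow> derives T \<Gamma> \<phi>"
| hyp: "\<lbrakk>\<phi> \<in> \<Gamma>; wf_fm \<phi>\<rbrakk> \<Longrightarrow> derives T \<Gamma> \<phi>"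
| BotE: "\<lbrakk>derives T \<Gamma> Bot; wf_fm \<phi>\<rbrakk> \<Longrightarrow> derives T \<Gamma> \<phi>"
| AndI: "\<lbrakk>derives T \<Gamma> \<phi>; derives T \<Gamma> \<psi>\<rbrakk> \<Longrightarrow> derives T \<Gamma> (And \<phi> \<psi>)"
| AndE1: "derives T \<Gamma> (And \<phi> \<psi>) \<Longrightarrow> derives T \<Gamma> \<phi>"
| AndE2: "derives T \<Gamma> (And \<phi> \<psi>) \<Longrightarrow> derives T \<Gamma> \<psi>"
| OrI1: "\<lbrakk>derives T \<Gamma> \<phi>; wf_fm \<psi>\<rbrakk> \<Longrightarrow> derives T \<Gamma> (Or \<phi> \<psi>)"
| OrI2: "\<lbrakk>derives T \<Gamma> \<psi>; wf_fm \<phi>\<rbrakk> \<Longrightarrow> derives T \<Gamma> (Or \<phi> \<psi>)"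
| OrE: "\<lbrakk>derives T \<Gamma> (Or \<phi> \<psi>); derives T (insert \<phi> \<Gamma>) \<chi>; derives T (insert \<psi> \<Gamma>) \<chi>\<rbrakk>
    \<Longrightarrow> derives T \<Gamma> \<chi>"
| ImpI: "\<lbrakk>derives T (insert \<phi> \<Gamma>) \<psi>; wf_fm \<phi>\<rbrakk> \<Longrightarrow> derives T \<Gamma> (Imp \<phi> \<psi>)"
| ImpE: "\<lbrakk>derives T \<Gamma> (Imp \<phi> \<psi>); derives T \<Gamma> \<phi>\<rbrakk> \<Longrightarrow> derives T \<Gamma> \<psi>"
| AllI: "derives T (lift ` \<Gamma>) \<phi> \<Longrightarrow> derives T \<Gamma> (All \<phi>)"
| AllE: "\<lbrakk>derives T \<Gamma> (All \<phi>); wf_tm t\<rbrakk> \<Longrightarrow> derives T \<Gamma> (inst t \<phi>)"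
| ExI: "\<lbrakk>derives T \<Gamma> (inst t \<phi>); wf_tm t; wf_fm \<phi>\<rbrakk> \<Longrightarrow> derives T \<Gamma> (Ex \<phi>)"
| ExE: "\<lbrakk>derives T \<Gamma> (Ex \<phi>); derives T (insert \<phi> (lift ` \<Gamma>)) (lift \<psi>)\<rbrakk> \<Longrightarrow> derives T \<Gamma> \<psi>"
| EqI: "wf_tm t \<Longrightarrow> derives T \<Gamma> (Eq t t)"
| EqE: "\<lbrakk>derives T \<Gamma> (Eq s t); derives T \<Gamma> (inst s \<phi>); wf_fm \<phi>\<rbrakk> \<Longrightarrow> derives T \<Gamma> (inst t \<phi>)"

abbreviation provable :: "fm set \<Rightarrow> fm \<Rightarrow> bool" (infix \<open>\<turnstile>\<close> 50) where
  "T \<turnstile> \<phi> \<equiv> derives T {} \<phi>"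

inductive_set HA :: "fm set" where
  Succ_not_Zero: "Neg (Eq (Succ t) Zero) \<in> HA"
| Succ_inject: "Imp (Eq (Succ s) (Succ t)) (Eq s t) \<in> HA"
| Proj: "\<lbrakk>length ts = n; i < n\<rbrakk> \<Longrightarrow> Eq (Fn (Proj n i) ts) (ts ! i) \<in> HA"
| Comp: "Eq (Fn (Comp n f gs) ts) (Fn f (map (\<lambda>g. Fn g ts) gs)) \<in> HA"
| Rec_Zero: "Eq (Fn (Rec g h) (Zero # ts)) (Fn g ts) \<in> HA"
| Rec_Succ: "Eq (Fn (Rec g h) (Succ t # ts)) (Fn h (t # Fn (Rec g h) (t # ts) # ts)) \<in> HA"
| Induction: "Imp (And (inst Zero \<phi>) (All (Imp \<phi> (subst_Succ \<phi>)))) (All \<phi>) \<in> HA"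

definition LEM :: "fm set \<Rightarrow> fm set" where
  "LEM C = {Or \<phi> (Neg \<phi>) | \<phi>. \<phi> \<in> C}"

definition PA :: "fm set" where
  "PA = HA \<union> LEM UNIV"


section \<open>Classes of formulas\<close>

fun prime_fm :: "fm \<Rightarrow> bool" where
  "prime_fm (Eq s t) \<longleftrightarrow> True"
| "prime_fm Bot \<longleftrightarrow> True"
| "prime_fm _ \<longleftrightarrow> False"

fun qfree :: "fm \<Rightarrow> bool" where
  "qfree (Eq s t) \<longleftrightarrow> True"
| "qfree Bot \<longleftrightarrow> True"
| "qfree (And \<phi> \<psi>) \<longleftrightarrow> qfree \<phi> \<and> qfree \<psi>"
| "qfree (Or \<phi> \<psi>) \<longleftrightarrow> qfree \<phi> \<and> qfree \<psi>"
| "qfree (Imp \<phi> \<psi>) \<longleftrightarrow> qfree \<phi> \<and> qfree \<psi>"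
| "qfree (All \<phi>) \<longleftrightarrow> False"
| "qfree (Ex \<phi>) \<longleftrightarrow> False"

text \<open>Quantifier blocks are nonempty, so that \<open>\<Sigma>\<^sub>k\<close> and \<open>\<Pi>\<^sub>k\<close> consist of formulas of degree
  exactly \<open>k\<close>.\<close>

fun Sigma_fm :: "nat \<Rightarrow> fm set" and Pi_fm :: "nat \<Rightarrow> fm set" where
  "Sigma_fm 0 = {\<phi>. qfree \<phi>}"
| "Sigma_fm (Suc k) = {(Ex ^^ n) \<phi> | n \<phi>. n \<ge> 1 \<and> \<phi> \<in> Pi_fm k}"
| "Pi_fm 0 = {\<phi>. qfree \<phi>}"
| "Pi_fm (Suc k) = {(All ^^ n) \<phi> | n \<phi>. n \<ge> 1 \<and> \<phi> \<in> Sigma_fm k}"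

datatype sign = Plus | Minus

fun opposite :: "sign \<Rightarrow> sign" where
  "opposite Plus = Minus"
| "opposite Minus = Plus"

text \<open>The first symbol of a path; \<^const>\<open>None\<close> plays the role of the third symbol \<open>\<times>\<close>.\<close>

definition init :: "sign list \<Rightarrow> sign option" where
  "init s = (case s of [] \<Rightarrow> None | a # _ \<Rightarrow> Some a)"

fun Alt :: "fm \<Rightarrow> sign list set" where
  "Alt (Eq s t) = {[]}"
| "Alt Bot = {[]}"
| "Alt (And \<phi> \<psi>) = (if qfree (And \<phi> \<psi>) then {[]} else Alt \<phi> \<union> Alt \<psi>)"
| "Alt (Or \<phi> \<psi>) = (if qfree (Or \<phi> \<psi>) then {[]} else Alt \<phi> \<union> Alt \<psi>)"
| "Alt (Imp \<phi> \<psi>) = (if qfree (Imp \<phi> \<psi>) then {[]} else map opposite ` Alt \<phi> \<union> Alt \<psi>)"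
| "Alt (All \<phi>) = {s \<in> Alt \<phi>. init s = Some Minus}
     \<union> {Minus # s | s. s \<in> Alt \<phi> \<and> init s \<noteq> Some Minus}"
| "Alt (Ex \<phi>) = {s \<in> Alt \<phi>. init s = Some Plus}
     \<union> {Plus # s | s. s \<in> Alt \<phi> \<and> init s \<noteq> Some Plus}"

definition deg :: "fm \<Rightarrow> nat" where
  "deg \<phi> = Max (length ` Alt \<phi>)"

definition F_plus :: "nat \<Rightarrow> fm set" where
  "F_plus k = {\<phi>. deg \<phi> \<le> k}"

inductive in_R :: "nat \<Rightarrow> fm \<Rightarrow> bool" and in_J :: "nat \<Rightarrow> fm \<Rightarrow> bool" where
  R_zero: "\<phi> \<in> Sigma_fm 0 \<Longrightarrow> in_R 0 \<phi>"
| J_zero: "\<phi> \<in> Sigma_fm 0 \<Longrightarrow> in_J 0 \<phi>"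
| R_F: "\<phi> \<in> F_plus k \<Longrightarrow> in_R (Suc k) \<phi>"
| J_F: "\<phi> \<in> F_plus k \<Longrightarrow> in_J (Suc k) \<phi>"
| R_And: "\<lbrakk>in_R (Suc k) \<phi>; in_R (Suc k) \<psi>\<rbrakk> \<Longrightarrow> in_R (Suc k) (And \<phi> \<psi>)"
| R_Or: "\<lbrakk>in_R (Suc k) \<phi>; in_R (Suc k) \<psi>\<rbrakk> \<Longrightarrow> in_R (Suc k) (Or \<phi> \<psi>)"
| R_All: "in_R (Suc k) \<phi> \<Longrightarrow> in_R (Suc k) (All \<phi>)"
| R_Imp: "\<lbrakk>in_J (Suc k) \<phi>; in_R (Suc k) \<psi>\<rbrakk> \<Longrightarrow> in_R (Suc k) (Imp \<phi> \<psi>)"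
| J_And: "\<lbrakk>in_J (Suc k) \<phi>; in_J (Suc k) \<psi>\<rbrakk> \<Longrightarrow> in_J (Suc k) (And \<phi> \<psi>)"
| J_Or: "\<lbrakk>in_J (Suc k) \<phi>; in_J (Suc k) \<psi>\<rbrakk> \<Longrightarrow> in_J (Suc k) (Or \<phi> \<psi>)"
| J_Ex: "in_J (Suc k) \<phi> \<Longrightarrow> in_J (Suc k) (Ex \<phi>)"
| J_Imp: "\<lbrakk>in_R (Suc k) \<phi>; in_J (Suc k) \<psi>\<rbrakk> \<Longrightarrow> in_J (Suc k) (Imp \<phi> \<psi>)"

inductive in_Q :: "nat \<Rightarrow> fm \<Rightarrow> bool" where
  Q_zero: "\<phi> \<in> Sigma_fm 0 \<Longrightarrow> in_Q 0 \<phi>"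
| Q_prime: "prime_fm \<phi> \<Longrightarrow> in_Q (Suc k) \<phi>"
| Q_And: "\<lbrakk>in_Q (Suc k) \<phi>; in_Q (Suc k) \<psi>\<rbrakk> \<Longrightarrow> in_Q (Suc k) (And \<phi> \<psi>)"
| Q_Or: "\<lbrakk>in_Q (Suc k) \<phi>; in_Q (Suc k) \<psi>\<rbrakk> \<Longrightarrow> in_Q (Suc k) (Or \<phi> \<psi>)"
| Q_All: "in_Q (Suc k) \<phi> \<Longrightarrow> in_Q (Suc k) (All \<phi>)"
| Q_Ex: "in_Q (Suc k) \<phi> \<Longrightarrow> in_Q (Suc k) (Ex \<phi>)"
| Q_Imp: "\<lbrakk>in_J (Suc k) \<phi>; in_Q (Suc k) \<psi>\<rbrakk> \<Longrightarrow> in_Q (Suc k) (Imp \<phi> \<psi>)"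

text \<open>Only \<open>in_V (Suc k)\<close> is meaningful; \<open>in_V 0\<close> is empty.\<close>

inductive in_V :: "nat \<Rightarrow> fm \<Rightarrow> bool" where
  V_J: "in_J (Suc k) \<phi> \<Longrightarrow> in_V (Suc k) \<phi>"
| V_And: "\<lbrakk>in_V (Suc k) \<phi>; in_V (Suc k) \<psi>\<rbrakk> \<Longrightarrow> in_V (Suc k) (And \<phi> \<psi>)"
| V_All: "in_V (Suc k) \<phi> \<Longrightarrow> in_V (Suc k) (All \<phi>)"

end

theory Submission
  imports Defs
begin

text \<open>
  Write \<open>T\<close> for \<open>HA + LEM(\<Sigma>\<^sub>k)\<close> and \<open>\<phi>\<^sup>\<chi>\<close> for the negative (Goedel-Gentzen) translation in which \<open>\<bottom>\<close> is
  replaced by a formula \<open>\<chi>\<close>, so that \<open>PA \<turnstile> \<theta>\<close> implies \<open>HA \<turnstile> \<theta>\<^sup>\<chi>\<close> for every \<open>\<chi>\<close>.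

  Prenex normal forms of formulas of degree at most \<open>k\<close> are available in \<open>T\<close>, hence \<open>T\<close> decides
  all such formulas \<open>F\<close> and proves that \<open>F\<^sup>\<chi>\<close> is equivalent to \<open>F \<or> \<chi>\<close>. By simultaneous induction
  it follows that \<open>T\<close> proves \<open>(\<not>R \<rightarrow> \<chi>) \<rightarrow> R\<^sup>\<chi>\<close> for \<open>R \<in> \<R>\<^bsub>k+1\<^esub>\<close> and
  \<open>J\<^sup>\<chi> \<rightarrow> ((J \<rightarrow> \<chi>) \<rightarrow> \<chi>)\<close> for \<open>J \<in> \<J>\<^bsub>k+1\<^esub>\<close>, and then \<open>Q \<rightarrow> Q\<^sup>\<chi>\<close> for \<open>Q \<in> \<Q>\<^bsub>k+1\<^esub>\<close>.
  If \<open>\<phi> \<in> \<J>\<^bsub>k+1\<^esub>\<close>, the choice \<open>\<chi> = \<phi>\<close> turns the translated proof of \<open>\<psi> \<rightarrow> \<phi>\<close> into a proof of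
  \<open>\<psi> \<rightarrow> ((\<phi> \<rightarrow> \<phi>) \<rightarrow> \<phi>)\<close>, that is, of \<open>\<psi> \<rightarrow> \<phi>\<close>. Conjunctions and universal quantifiers in
  front of \<open>\<J>\<^bsub>k+1\<^esub>\<close> formulas are split off first.
\<close>

section \<open>Substitution and derivability\<close>

lemma subst_tm_Var [simp]: "subst_tm Var t = t"
  by (induction t) (auto intro: map_idI)

lemma subst_tm_comp: "subst_tm \<sigma> (subst_tm \<tau> t) = subst_tm (\<lambda>n. subst_tm \<sigma> (\<tau> n)) t"
  by (induction t) auto

lemma under_binder_0 [simp]: "under_binder \<sigma> 0 = Var 0"
  by (simp add: under_binder_def)

lemma under_binder_Suc [simp]: "under_binder \<sigma> (Suc n) = subst_tm (\<lambda>m. Var (Suc m)) (\<sigma> n)"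
  by (simp add: under_binder_def)

lemma under_binder_Var [simp]: "under_binder Var = Var"
proof
  fix n show "under_binder Var n = Var n" by (cases n) auto
qed

lemma under_binder_comp:
  "(\<lambda>n. subst_tm (under_binder \<sigma>) (under_binder \<tau> n)) = under_binder (\<lambda>n. subst_tm \<sigma> (\<tau> n))"
proof
  fix n
  show "subst_tm (under_binder \<sigma>) (under_binder \<tau> n) = under_binder (\<lambda>n. subst_tm \<sigma> (\<tau> n)) n"
    by (cases n) (auto simp: subst_tm_comp)
qed

lemma subst_Var [simp]: "subst Var \<phi> = \<phi>"
  by (induction \<phi>) auto

lemma subst_comp: "subst \<sigma> (subst \<tau> \<phi>) = subst (\<lambda>n. subst_tm \<sigma> (\<tau> n)) \<phi>"
  by (induction \<phi> arbitrary: \<sigma> \<tau>) (auto simp: subst_tm_comp under_binder_comp)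

lemma lift_simps [simp]:
  "lift (Eq s t) = Eq (subst_tm (\<lambda>n. Var (Suc n)) s) (subst_tm (\<lambda>n. Var (Suc n)) t)"
  "lift Bot = Bot"
  "lift (And \<phi> \<psi>) = And (lift \<phi>) (lift \<psi>)"
  "lift (Or \<phi> \<psi>) = Or (lift \<phi>) (lift \<psi>)"
  "lift (Imp \<phi> \<psi>) = Imp (lift \<phi>) (lift \<psi>)"
  by (simp_all add: lift_def)

lemma subst_under_binder_lift: "subst (under_binder \<sigma>) (lift \<phi>) = lift (subst \<sigma> \<phi>)"
  by (simp add: lift_def subst_comp)

lemma inst_lift [simp]: "inst t (lift \<phi>) = \<phi>"
  by (simp add: lift_def inst_def subst_comp)

lemma subst_Succ_lift: "subst_Succ (lift \<phi>) = lift \<phi>"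
  by (simp add: lift_def subst_Succ_def subst_comp)

lemma subst_inst: "subst \<sigma> (inst t \<phi>) = inst (subst_tm \<sigma> t) (subst (under_binder \<sigma>) \<phi>)"
proof -
  have "(\<lambda>n. subst_tm \<sigma> (case n of 0 \<Rightarrow> t | Suc m \<Rightarrow> Var m)) =
      (\<lambda>n. subst_tm (case_nat (subst_tm \<sigma> t) Var) (under_binder \<sigma> n))"
    by (auto simp: fun_eq_iff subst_tm_comp split: nat.split)
  then show ?thesis
    by (simp add: inst_def subst_comp)
qed

lemma subst_subst_Succ:
  "subst (under_binder \<sigma>) (subst_Succ \<phi>) = subst_Succ (subst (under_binder \<sigma>) \<phi>)"
proof -
  have "(\<lambda>n. subst_tm (under_binder \<sigma>) (case n of 0 \<Rightarrow> Succ (Var 0) | Suc m \<Rightarrow> Var (Suc m))) =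
      (\<lambda>n. subst_tm (case_nat (Succ (Var 0)) (\<lambda>n. Var (Suc n))) (under_binder \<sigma> n))"
    by (auto simp: fun_eq_iff subst_tm_comp split: nat.split)
  then show ?thesis
    by (simp add: subst_Succ_def subst_comp)
qed

text \<open>Below a binder, lifting shifts only the indices above 0; instantiation with
  \<open>Var 0\<close> shifts them back and makes the bound variable the eigenvariable.\<close>

lemma inst_Var0_under_binder [simp]:
  "inst (Var 0) (subst (under_binder (\<lambda>n. Var (Suc n))) \<phi>) = \<phi>"
proof -
  have "(\<lambda>n. subst_tm (case_nat (Var 0) Var) (under_binder (\<lambda>n. Var (Suc n)) n)) = Var"
    by (auto simp: fun_eq_iff under_binder_def split: nat.split)
  then show ?thesis
    by (simp add: inst_def subst_comp)
qed

lemma wf_subst_tm: "wf_tm t \<Longrightarrow> (\<And>n. wf_tm (\<sigma> n)) \<Longrightarrow> wf_tm (subst_tm \<sigma> t)"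
  by (induction t) auto

lemma wf_subst_tm_D: "wf_tm (subst_tm \<sigma> t) \<Longrightarrow> wf_tm t"
  by (induction t) auto

lemma wf_under_binder: "(\<And>n. wf_tm (\<sigma> n)) \<Longrightarrow> wf_tm (under_binder \<sigma> n)"
  by (cases n) (auto intro: wf_subst_tm)

lemma wf_subst: "wf_fm \<phi> \<Longrightarrow> (\<And>n. wf_tm (\<sigma> n)) \<Longrightarrow> wf_fm (subst \<sigma> \<phi>)"
  by (induction \<phi> arbitrary: \<sigma>) (auto intro: wf_subst_tm wf_under_binder)

lemma wf_subst_D: "wf_fm (subst \<sigma> \<phi>) \<Longrightarrow> wf_fm \<phi>"
  by (induction \<phi> arbitrary: \<sigma>) (auto dest: wf_subst_tm_D)

lemma wf_lift [simp]: "wf_fm (lift \<phi>) = wf_fm \<phi>"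
  by (auto simp: lift_def intro: wf_subst wf_subst_D)

lemma wf_inst: "wf_fm \<phi> \<Longrightarrow> wf_tm t \<Longrightarrow> wf_fm (inst t \<phi>)"
  unfolding inst_def by (rule wf_subst) (auto split: nat.split)

section \<open>Admissible structural rules: weakening and substitution\<close>

lemma derives_wf: "derives T \<Gamma> \<phi> \<Longrightarrow> wf_fm \<phi>"
  by (induction rule: derives.induct) (auto intro: wf_inst)

lemma derives_mono: "derives T \<Gamma> \<phi> \<Longrightarrow> \<Gamma> \<subseteq> \<Delta> \<Longrightarrow> derives T \<Delta> \<phi>"
proof (induction arbitrary: \<Delta> rule: derives.induct)
  case (OrE \<Gamma> \<phi> \<psi> \<chi>)
  then show ?case by (meson derives.OrE insert_mono)
next
  case (ImpI \<phi> \<Gamma> \<psi>)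
  then show ?case by (meson derives.ImpI insert_mono)
next
  case (ImpE \<Gamma> \<phi> \<psi>)
  then show ?case by (meson derives.ImpE)
next
  case (AllI \<Gamma> \<phi>)
  then show ?case by (meson derives.AllI image_mono)
next
  case (ExE \<Gamma> \<phi> \<psi>)
  then show ?case by (meson derives.ExE image_mono insert_mono)
next
  case (EqE \<Gamma> s t \<phi>)
  then show ?case by (meson derives.EqE)
qed (blast intro: derives.intros)+

text \<open>Substituting into a derivation leaves \<open>T\<close> in place, so an axiom used in it
  must again be an axiom after the substitution.\<close>

definition subst_closed :: "fm set \<Rightarrow> bool" where
  "subst_closed T \<longleftrightarrow> (\<forall>\<phi> \<in> T. \<forall>\<sigma>. subst \<sigma> \<phi> \<in> T)"

text \<open>In the eigenvariable rules \<open>AllI\<close> and \<open>ExE\<close> the induction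
  hypothesis is taken at \<open>under_binder \<sigma>\<close>, which commutes with lifting by
  \<open>subst_under_binder_lift\<close>; for this reason \<open>\<sigma>\<close> is
  generalised.\<close>

lemma derives_subst:
  assumes "subst_closed T"
  shows "derives T \<Gamma> \<phi> \<Longrightarrow> (\<And>n. wf_tm (\<sigma> n)) \<Longrightarrow> derives T (subst \<sigma> ` \<Gamma>) (subst \<sigma> \<phi>)"
proof (induction arbitrary: \<sigma> rule: derives.induct)
  case (axiom \<phi> \<Gamma>)
  then show ?case using assms by (auto simp: subst_closed_def intro: derives.axiom wf_subst)
next
  case (hyp \<phi> \<Gamma>)
  then show ?case by (auto intro: derives.hyp wf_subst)
next
  case (BotE \<Gamma> \<phi>)
  from BotE.IH[of \<sigma>] BotE.hyps BotE.prems show ?case by (simp add: derives.BotE wf_subst)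
next
  case (AndE1 \<Gamma> \<phi> \<psi>)
  from AndE1.IH[of \<sigma>, OF AndE1.prems] show ?case by (simp add: derives.AndE1)
next
  case (AndE2 \<Gamma> \<phi> \<psi>)
  from AndE2.IH[of \<sigma>, OF AndE2.prems] show ?case by (simp add: derives.AndE2)
next
  case (OrE \<Gamma> \<phi> \<psi> \<chi>)
  from OrE.IH[of \<sigma>, OF OrE.prems] show ?case by (simp add: derives.OrE)
next
  case (ImpE \<Gamma> \<phi> \<psi>)
  from ImpE.IH[of \<sigma>, OF ImpE.prems] show ?case by (simp add: derives.ImpE)
next
  case (AllI \<Gamma> \<phi>)
  have "derives T (subst (under_binder \<sigma>) ` lift ` \<Gamma>) (subst (under_binder \<sigma>) \<phi>)"
    using AllI by (intro AllI.IH wf_under_binder)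
  then show ?case by (simp add: image_image subst_under_binder_lift derives.AllI)
next
  case (AllE \<Gamma> \<phi> t)
  from AllE.IH[of \<sigma>, OF AllE.prems] AllE.hyps AllE.prems show ?case
    by (simp add: subst_inst derives.AllE wf_subst_tm)
next
  case (ExI \<Gamma> t \<phi>)
  have "derives T (subst \<sigma> ` \<Gamma>) (inst (subst_tm \<sigma> t) (subst (under_binder \<sigma>) \<phi>))"
    using ExI.IH[of \<sigma>, OF ExI.prems] by (simp add: subst_inst)
  with ExI.hyps ExI.prems show ?case
    by (auto intro!: derives.ExI wf_subst_tm wf_subst wf_under_binder)
next
  case (ExE \<Gamma> \<phi> \<psi>)
  have "derives T (subst (under_binder \<sigma>) ` insert \<phi> (lift ` \<Gamma>)) (subst (under_binder \<sigma>) (lift \<psi>))"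
    using ExE.prems by (intro ExE.IH wf_under_binder)
  then show ?case using ExE.IH(1)[of \<sigma>, OF ExE.prems]
    by (simp add: image_image subst_under_binder_lift derives.ExE)
next
  case (EqE \<Gamma> s t \<phi>)
  have "derives T (subst \<sigma> ` \<Gamma>) (inst (subst_tm \<sigma> s) (subst (under_binder \<sigma>) \<phi>))"
    using EqE.IH(2)[of \<sigma>, OF EqE.prems] by (simp add: subst_inst)
  then have "derives T (subst \<sigma> ` \<Gamma>) (inst (subst_tm \<sigma> t) (subst (under_binder \<sigma>) \<phi>))"
    using EqE.IH(1)[of \<sigma>, OF EqE.prems] EqE.hyps EqE.prems
    by (intro derives.EqE[of _ _ "subst_tm \<sigma> s" "subst_tm \<sigma> t"] wf_subst wf_under_binder) simp_all
  then show ?case by (simp add: subst_inst)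
qed (auto intro: derives.AndI derives.OrI1 derives.OrI2 derives.ImpI derives.EqI
      wf_subst wf_subst_tm)

lemma derives_lift: "subst_closed T \<Longrightarrow> derives T \<Gamma> \<phi> \<Longrightarrow> derives T (lift ` \<Gamma>) (lift \<phi>)"
  unfolding lift_def by (rule derives_subst) auto

text \<open>Instantiating the lifted universal formula with the eigenvariable \<open>Var 0\<close>
  returns its body; after lifting a derivation this inverts \<open>AllI\<close>.\<close>

lemma AllE_lift: "derives T \<Gamma> (lift (All \<phi>)) \<Longrightarrow> derives T \<Gamma> \<phi>"
  using derives.AllE[of T \<Gamma> "subst (under_binder (\<lambda>n. Var (Suc n))) \<phi>" "Var 0"]
  by (simp add: lift_def)

lemma subst_closed_Un: "subst_closed S \<Longrightarrow> subst_closed T \<Longrightarrow> subst_closed (S \<union> T)"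
  by (auto simp: subst_closed_def)

lemma subst_closed_HA: "subst_closed HA"
  unfolding subst_closed_def
proof (intro ballI allI)
  fix \<phi> \<sigma> assume "\<phi> \<in> HA"
  then show "subst \<sigma> \<phi> \<in> HA"
  proof cases
    case (Comp n f gs ts)
    then show ?thesis using HA.Comp[of n f gs "map (subst_tm \<sigma>) ts"] by (simp add: o_def)
  next
    case (Induction \<psi>)
    then show ?thesis using HA.Induction[of "subst (under_binder \<sigma>) \<psi>"]
      by (simp add: subst_inst subst_subst_Succ)
  next
    case (Proj ts n i)
    then show ?thesis using HA.Proj[of "map (subst_tm \<sigma>) ts" n i] by simp
  qed (auto intro: HA.intros)
qed

lemma subst_closed_LEM: "(\<And>\<phi> \<sigma>. \<phi> \<in> C \<Longrightarrow> subst \<sigma> \<phi> \<in> C) \<Longrightarrow> subst_closed (LEM C)"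
  by (auto simp: subst_closed_def LEM_def)

text \<open>Only the shape of the quantifier block matters for membership in the arithmetical
  classes, so the substitution that arrives below \<open>n\<close> binders is left unnamed.\<close>

lemma subst_Ex_pow: "\<exists>\<tau>. subst \<sigma> ((Ex ^^ n) \<phi>) = (Ex ^^ n) (subst \<tau> \<phi>)"
  by (induction n arbitrary: \<sigma>) auto

lemma subst_All_pow: "\<exists>\<tau>. subst \<sigma> ((All ^^ n) \<phi>) = (All ^^ n) (subst \<tau> \<phi>)"
  by (induction n arbitrary: \<sigma>) auto

lemma qfree_subst [simp]: "qfree (subst \<sigma> \<phi>) = qfree \<phi>"
  by (induction \<phi> arbitrary: \<sigma>) auto

lemma subst_Sigma_Pi:
  "(\<phi> \<in> Sigma_fm k \<longrightarrow> subst \<sigma> \<phi> \<in> Sigma_fm k) \<and> (\<phi> \<in> Pi_fm k \<longrightarrow> subst \<sigma> \<phi> \<in> Pi_fm k)"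
proof (induction k arbitrary: \<phi> \<sigma>)
  case 0
  then show ?case by simp
next
  case (Suc k)
  then show ?case by clarsimp (metis subst_Ex_pow subst_All_pow)
qed

lemma subst_closed_HA_LEM: "subst_closed (HA \<union> LEM (Sigma_fm k))"
  using subst_Sigma_Pi by (intro subst_closed_Un subst_closed_HA subst_closed_LEM) blast

section \<open>The negative translation into an arbitrary formula\<close>

text \<open>For fixed \<open>\<chi>\<close> this is the continuation monad: \<open>dnegI\<close>,
  \<open>dneg_bind\<close> and \<open>dneg_join\<close> are its unit, bind and join.\<close>

definition dneg :: "fm \<Rightarrow> fm \<Rightarrow> fm" where
  "dneg \<chi> \<phi> = Imp (Imp \<phi> \<chi>) \<chi>"

text \<open>\<open>\<chi>\<close> may contain free variables; lifting it at each quantifier prevents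
  their capture.\<close>

fun ntrans :: "fm \<Rightarrow> fm \<Rightarrow> fm" where
  "ntrans \<chi> (Eq s t) = dneg \<chi> (Eq s t)"
| "ntrans \<chi> Bot = \<chi>"
| "ntrans \<chi> (And \<phi> \<psi>) = And (ntrans \<chi> \<phi>) (ntrans \<chi> \<psi>)"
| "ntrans \<chi> (Or \<phi> \<psi>) = dneg \<chi> (Or (ntrans \<chi> \<phi>) (ntrans \<chi> \<psi>))"
| "ntrans \<chi> (Imp \<phi> \<psi>) = Imp (ntrans \<chi> \<phi>) (ntrans \<chi> \<psi>)"
| "ntrans \<chi> (All \<phi>) = All (ntrans (lift \<chi>) \<phi>)"
| "ntrans \<chi> (Ex \<phi>) = dneg \<chi> (Ex (ntrans (lift \<chi>) \<phi>))"

lemma wf_dneg [simp]: "wf_fm (dneg \<chi> \<phi>) \<longleftrightarrow> wf_fm \<chi> \<and> wf_fm \<phi>"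
  by (auto simp: dneg_def)

lemma subst_dneg [simp]: "subst \<sigma> (dneg \<chi> \<phi>) = dneg (subst \<sigma> \<chi>) (subst \<sigma> \<phi>)"
  by (simp add: dneg_def)

lemma lift_dneg [simp]: "lift (dneg \<chi> \<phi>) = dneg (lift \<chi>) (lift \<phi>)"
  by (simp add: dneg_def)

lemma wf_ntrans [simp]: "wf_fm \<chi> \<Longrightarrow> wf_fm (ntrans \<chi> \<phi>) = wf_fm \<phi>"
  by (induction \<phi> arbitrary: \<chi>) auto

lemma subst_ntrans: "subst \<sigma> (ntrans \<chi> \<phi>) = ntrans (subst \<sigma> \<chi>) (subst \<sigma> \<phi>)"
  by (induction \<phi> arbitrary: \<chi> \<sigma>) (auto simp: subst_under_binder_lift)

lemma lift_ntrans: "lift (ntrans \<chi> \<phi>) = ntrans (lift \<chi>) (lift \<phi>)"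
  by (simp add: lift_def subst_ntrans)

text \<open>The lift of the parameter cancels against the instantiation, so quantifier rules,
  equality and induction are compatible with the translation.\<close>

lemma inst_ntrans: "inst t (ntrans (lift \<chi>) \<phi>) = ntrans \<chi> (inst t \<phi>)"
  using inst_lift[of t \<chi>] by (simp add: inst_def subst_ntrans)

lemma subst_Succ_ntrans: "subst_Succ (ntrans (lift \<chi>) \<phi>) = ntrans (lift \<chi>) (subst_Succ \<phi>)"
  using subst_Succ_lift[of \<chi>] by (simp add: subst_Succ_def subst_ntrans)

section \<open>The base theory and relative double negation\<close>

locale semiclassical =
  fixes T :: "fm set" and k :: nat
  assumes T_def: "T = HA \<union> LEM (Sigma_fm k)"
begin

abbreviation entails :: "fm set \<Rightarrow> fm \<Rightarrow> bool" (infix \<open>\<tturnstile>\<close> 50) where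
  "\<Gamma> \<tturnstile> \<phi> \<equiv> derives T \<Gamma> \<phi>"

lemma closed: "subst_closed T"
  unfolding T_def by (rule subst_closed_HA_LEM)

lemma weaken: "\<Gamma> \<tturnstile> \<phi> \<Longrightarrow> insert \<psi> \<Gamma> \<tturnstile> \<phi>"
  by (erule derives_mono) blast

lemma weaken_empty: "{} \<tturnstile> \<phi> \<Longrightarrow> \<Gamma> \<tturnstile> \<phi>"
  by (erule derives_mono) blast

lemma hyp_insert: "wf_fm \<phi> \<Longrightarrow> insert \<phi> \<Gamma> \<tturnstile> \<phi>"
  by (simp add: derives.hyp)

lemma cut: "\<Gamma> \<tturnstile> \<phi> \<Longrightarrow> insert \<phi> \<Gamma> \<tturnstile> \<psi> \<Longrightarrow> \<Gamma> \<tturnstile> \<psi>"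
  by (meson derives.ImpE derives.ImpI derives_wf)

lemma lift_entails: "\<Gamma> \<tturnstile> \<phi> \<Longrightarrow> lift ` \<Gamma> \<tturnstile> lift \<phi>"
  by (rule derives_lift[OF closed])

text \<open>The eigenvariable \<open>Var 0\<close> serves as the witness; this is the existential
  counterpart of \<open>AllE_lift\<close>.\<close>

lemma ExI_lift: "\<Gamma> \<tturnstile> \<phi> \<Longrightarrow> \<Gamma> \<tturnstile> lift (Ex \<phi>)"
  using derives.ExI[of T \<Gamma> "Var 0" "subst (under_binder (\<lambda>n. Var (Suc n))) \<phi>"]
  by (simp add: lift_def derives_wf wf_subst wf_under_binder)

lemma dnegI: "\<Gamma> \<tturnstile> \<phi> \<Longrightarrow> wf_fm \<chi> \<Longrightarrow> \<Gamma> \<tturnstile> dneg \<chi> \<phi>"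
  unfolding dneg_def
  by (rule derives.ImpI, rule derives.ImpE[OF hyp_insert weaken]) (auto dest: derives_wf)

lemma dneg_bind:
  assumes "\<Gamma> \<tturnstile> dneg \<chi> \<phi>" and "insert \<phi> \<Gamma> \<tturnstile> dneg \<chi> \<psi>"
  shows "\<Gamma> \<tturnstile> dneg \<chi> \<psi>"
proof -
  have wf: "wf_fm \<phi>" "wf_fm \<chi>" "wf_fm \<psi>"
    using assms[THEN derives_wf] by auto
  have "insert \<phi> (insert (Imp \<psi> \<chi>) \<Gamma>) \<tturnstile> \<chi>"
    using wf
    by (rule_tac derives.ImpE[OF derives_mono[OF assms(2)[unfolded dneg_def]]]) (auto intro: derives.hyp)
  then have "insert (Imp \<psi> \<chi>) \<Gamma> \<tturnstile> Imp \<phi> \<chi>"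
    using wf by (intro derives.ImpI)
  moreover have "insert (Imp \<psi> \<chi>) \<Gamma> \<tturnstile> Imp (Imp \<phi> \<chi>) \<chi>"
    using assms(1) unfolding dneg_def by (rule weaken)
  ultimately have "insert (Imp \<psi> \<chi>) \<Gamma> \<tturnstile> \<chi>"
    by (rule derives.ImpE[rotated])
  then show ?thesis
    unfolding dneg_def using wf by (intro derives.ImpI) auto
qed

lemma dneg_from_target: "\<Gamma> \<tturnstile> \<chi> \<Longrightarrow> wf_fm \<phi> \<Longrightarrow> \<Gamma> \<tturnstile> dneg \<chi> \<phi>"
  unfolding dneg_def by (rule derives.ImpI) (auto intro: weaken dest: derives_wf)

text \<open>The premise is applied to the trivial implication from \<open>\<chi>\<close> to itself.
  This is the point at which choosing \<open>\<chi>\<close> as the formula to be proved pays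
  off.\<close>

lemma dneg_target: "\<Gamma> \<tturnstile> dneg \<chi> \<chi> \<Longrightarrow> \<Gamma> \<tturnstile> \<chi>"
  using derives_wf[of T \<Gamma> "dneg \<chi> \<chi>"] unfolding dneg_def
  by (auto intro!: derives.ImpI hyp_insert elim!: derives.ImpE)

lemma dneg_join: "\<Gamma> \<tturnstile> dneg \<chi> (dneg \<chi> \<phi>) \<Longrightarrow> \<Gamma> \<tturnstile> dneg \<chi> \<phi>"
  using derives_wf[of T \<Gamma> "dneg \<chi> (dneg \<chi> \<phi>)"] by (auto elim!: dneg_bind intro!: hyp_insert)

text \<open>Each clause of the translation either is \<open>\<chi>\<close> or a \<open>dneg\<close>
  already, or is a conjunction, implication or universal quantification, through which
  \<open>dneg\<close> distributes to stable components.\<close>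

lemma ntrans_stable: "\<Gamma> \<tturnstile> dneg \<chi> (ntrans \<chi> \<phi>) \<Longrightarrow> \<Gamma> \<tturnstile> ntrans \<chi> \<phi>"
proof (induction \<phi> arbitrary: \<Gamma> \<chi>)
  case (Eq s t)
  then show ?case unfolding ntrans.simps by (rule dneg_join)
next
  case Bot
  then show ?case unfolding ntrans.simps by (rule dneg_target)
next
  case (And \<phi> \<psi>)
  from derives_wf[OF And.prems]
  have wf: "wf_fm (ntrans \<chi> \<phi>)" "wf_fm (ntrans \<chi> \<psi>)" "wf_fm \<chi>" by auto
  then have h: "insert (And (ntrans \<chi> \<phi>) (ntrans \<chi> \<psi>)) \<Gamma> \<tturnstile> And (ntrans \<chi> \<phi>) (ntrans \<chi> \<psi>)"
    by (simp add: hyp_insert)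
  have "\<Gamma> \<tturnstile> dneg \<chi> (ntrans \<chi> \<phi>)" "\<Gamma> \<tturnstile> dneg \<chi> (ntrans \<chi> \<psi>)"
    using dneg_bind[OF And.prems[unfolded ntrans.simps] dnegI] derives.AndE1[OF h] derives.AndE2[OF h] wf
    by auto
  then show ?case using And.IH unfolding ntrans.simps by (intro derives.AndI)
next
  case (Or \<phi> \<psi>)
  from Or.prems show ?case unfolding ntrans.simps by (rule dneg_join)
next
  case (Imp \<phi> \<psi>)
  from derives_wf[OF Imp.prems]
  have wf: "wf_fm (ntrans \<chi> \<phi>)" "wf_fm (ntrans \<chi> \<psi>)" "wf_fm \<chi>" by auto
  let ?D = "Imp (ntrans \<chi> \<phi>) (ntrans \<chi> \<psi>)"
  have "insert ?D (insert (ntrans \<chi> \<phi>) \<Gamma>) \<tturnstile> ntrans \<chi> \<psi>"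
    using wf by (rule_tac derives.ImpE[OF hyp_insert derives.hyp]) auto
  then have "insert (ntrans \<chi> \<phi>) \<Gamma> \<tturnstile> dneg \<chi> (ntrans \<chi> \<psi>)"
    using wf(3) by (rule dneg_bind[OF weaken[OF Imp.prems[unfolded ntrans.simps]] dnegI])
  then show ?case using wf Imp.IH unfolding ntrans.simps by (intro derives.ImpI)
next
  case (All \<phi>)
  from derives_wf[OF All.prems] have wf: "wf_fm (ntrans (lift \<chi>) \<phi>)" "wf_fm \<chi>" by auto
  let ?D = "lift (All (ntrans (lift \<chi>) \<phi>))"
  have "insert ?D (lift ` \<Gamma>) \<tturnstile> dneg (lift \<chi>) (ntrans (lift \<chi>) \<phi>)"
    using wf by (rule_tac dnegI[OF AllE_lift[OF hyp_insert]]) auto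
  moreover have "lift ` \<Gamma> \<tturnstile> dneg (lift \<chi>) ?D"
    using lift_entails[OF All.prems] by simp
  ultimately have "lift ` \<Gamma> \<tturnstile> dneg (lift \<chi>) (ntrans (lift \<chi>) \<phi>)"
    by (rule dneg_bind[rotated])
  then show ?case using All.IH unfolding ntrans.simps by (intro derives.AllI)
next
  case (Ex \<phi>)
  from Ex.prems show ?case unfolding ntrans.simps by (rule dneg_join)
qed

text \<open>Since translations are stable, the \<open>dneg\<close> in front of a fact may be dropped
  whenever the goal is a translation.\<close>

lemma ntrans_bind: "\<Gamma> \<tturnstile> dneg \<chi> \<phi> \<Longrightarrow> insert \<phi> \<Gamma> \<tturnstile> ntrans \<chi> \<psi> \<Longrightarrow> \<Gamma> \<tturnstile> ntrans \<chi> \<psi>"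
  using derives_wf[of T \<Gamma> "dneg \<chi> \<phi>"] by (auto intro: ntrans_stable dneg_bind dnegI)

lemma ntrans_from_target: "\<Gamma> \<tturnstile> \<chi> \<Longrightarrow> wf_fm \<phi> \<Longrightarrow> \<Gamma> \<tturnstile> ntrans \<chi> \<phi>"
  by (rule ntrans_stable, rule dneg_from_target) (auto dest: derives_wf)

text \<open>A map from the disjunction to \<open>\<chi>\<close> gives one from \<open>\<phi>\<close>
  to \<open>\<chi>\<close>, and that is the right disjunct. For a translated formula
  \<open>\<phi>\<close> this is the translation of an instance of excluded middle.\<close>

lemma dneg_excluded_middle: "wf_fm \<chi> \<Longrightarrow> wf_fm \<phi> \<Longrightarrow> \<Gamma> \<tturnstile> dneg \<chi> (Or \<phi> (Imp \<phi> \<chi>))"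
proof -
  assume wf: "wf_fm \<chi>" "wf_fm \<phi>"
  let ?D = "Or \<phi> (Imp \<phi> \<chi>)"
  have 1: "insert \<phi> (insert (Imp ?D \<chi>) \<Gamma>) \<tturnstile> \<chi>"
    using wf by (rule_tac derives.ImpE[where \<phi> = ?D]) (auto intro: derives.hyp derives.OrI1)
  have "insert (Imp ?D \<chi>) \<Gamma> \<tturnstile> \<chi>"
    using wf derives.ImpI[OF 1] by (rule_tac derives.ImpE[where \<phi> = ?D]) (auto intro: derives.hyp derives.OrI2)
  then show ?thesis unfolding dneg_def using wf by (intro derives.ImpI) auto
qed

section \<open>Soundness of the translation\<close>

lemma HA_axiom: "\<phi> \<in> HA \<Longrightarrow> wf_fm \<phi> \<Longrightarrow> \<Gamma> \<tturnstile> \<phi>"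
  by (rule derives.axiom) (auto simp: T_def)

text \<open>Equational axioms only gain a \<open>dneg\<close>; in the two successor axioms the
  \<open>dneg\<close> of the premise is removed by \<open>ntrans_bind\<close>; an instance of
  induction becomes another instance of induction.\<close>

lemma ntrans_HA_axiom:
  assumes "\<phi> \<in> HA" and "wf_fm \<phi>" and "wf_fm \<chi>"
  shows "\<Gamma> \<tturnstile> ntrans \<chi> \<phi>"
  using assms(1)
proof cases
  case (Succ_not_Zero t)
  \<comment> \<open>The conclusion \<open>\<chi>\<close> is written as the translation of
    \<open>Bot\<close>, so that \<open>ntrans_bind\<close> applies.\<close>
  have "insert (dneg \<chi> (Eq (Succ t) Zero)) \<Gamma> \<tturnstile> ntrans \<chi> Bot"
  proof (rule ntrans_bind)
    show "insert (dneg \<chi> (Eq (Succ t) Zero)) \<Gamma> \<tturnstile> dneg \<chi> (Eq (Succ t) Zero)"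
      using Succ_not_Zero assms by (intro hyp_insert) auto
    show "insert (Eq (Succ t) Zero) (insert (dneg \<chi> (Eq (Succ t) Zero)) \<Gamma>) \<tturnstile> ntrans \<chi> Bot"
      using assms Succ_not_Zero HA_axiom[OF assms(1,2)]
      by (auto intro: derives.BotE[OF derives.ImpE[OF _ hyp_insert]])
  qed
  then show ?thesis using Succ_not_Zero assms by (auto intro!: derives.ImpI)
next
  case (Succ_inject s t)
  have "insert (ntrans \<chi> (Eq (Succ s) (Succ t))) \<Gamma> \<tturnstile> ntrans \<chi> (Eq s t)"
  proof (rule ntrans_bind)
    show "insert (ntrans \<chi> (Eq (Succ s) (Succ t))) \<Gamma> \<tturnstile> dneg \<chi> (Eq (Succ s) (Succ t))"
      using Succ_inject assms by (auto intro!: hyp_insert)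
    show "insert (Eq (Succ s) (Succ t)) (insert (ntrans \<chi> (Eq (Succ s) (Succ t))) \<Gamma>) \<tturnstile> ntrans \<chi> (Eq s t)"
      using assms Succ_inject HA_axiom[OF assms(1,2)]
      by (auto intro: dnegI[OF derives.ImpE[OF _ hyp_insert]])
  qed
  then show ?thesis using Succ_inject assms by (auto intro!: derives.ImpI)
next
  case (Induction \<psi>)
  have "Imp (And (inst Zero (ntrans (lift \<chi>) \<psi>))
        (All (Imp (ntrans (lift \<chi>) \<psi>) (subst_Succ (ntrans (lift \<chi>) \<psi>))))) (All (ntrans (lift \<chi>) \<psi>)) \<in> HA"
    by (rule HA.Induction)
  then have "ntrans \<chi> \<phi> \<in> HA"
    using Induction by (simp add: inst_ntrans subst_Succ_ntrans)
  then show ?thesis using assms by (intro HA_axiom) auto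
qed (use assms HA_axiom[OF assms(1,2)] in \<open>auto intro!: dnegI\<close>)

text \<open>Introductions for disjunction, existence and equality are followed by
  \<open>dnegI\<close>, and their eliminations are handled by \<open>ntrans_bind\<close>; ex falso
  becomes \<open>ntrans_from_target\<close>. \<open>\<chi>\<close> is generalised because
  \<open>AllI\<close> and \<open>ExE\<close> use the induction hypothesis at
  \<open>lift \<chi>\<close>.\<close>

theorem ntrans_sound: "derives PA \<Gamma> \<phi> \<Longrightarrow> wf_fm \<chi> \<Longrightarrow> ntrans \<chi> ` \<Gamma> \<tturnstile> ntrans \<chi> \<phi>"
proof (induction arbitrary: \<chi> rule: derives.induct)
  case (axiom \<phi> \<Gamma>)
  show ?case
  proof (cases "\<phi> \<in> HA")
    case True
    then show ?thesis using axiom by (intro ntrans_HA_axiom)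
  next
    case False
    then obtain \<psi> where "\<phi> = Or \<psi> (Neg \<psi>)" using axiom by (auto simp: PA_def LEM_def)
    then show ?thesis using axiom by (auto intro!: dneg_excluded_middle)
  qed
next
  case (hyp \<phi> \<Gamma>)
  then show ?case by (auto intro!: derives.hyp)
next
  case (BotE \<Gamma> \<phi>)
  from BotE.IH[of \<chi>] BotE.hyps BotE.prems show ?case by (simp add: ntrans_from_target)
next
  case (AndI \<Gamma> \<phi> \<psi>)
  then show ?case by (simp add: derives.AndI)
next
  case (AndE1 \<Gamma> \<phi> \<psi>)
  from AndE1.IH[OF AndE1.prems] show ?case unfolding ntrans.simps by (rule derives.AndE1)
next
  case (AndE2 \<Gamma> \<phi> \<psi>)
  from AndE2.IH[OF AndE2.prems] show ?case unfolding ntrans.simps by (rule derives.AndE2)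
next
  case (OrI1 \<Gamma> \<phi> \<psi>)
  then show ?case by (simp add: dnegI derives.OrI1)
next
  case (OrI2 \<Gamma> \<psi> \<phi>)
  then show ?case by (simp add: dnegI derives.OrI2)
next
  case (OrE \<Gamma> \<phi> \<psi> \<theta>)
  let ?D = "Or (ntrans \<chi> \<phi>) (ntrans \<chi> \<psi>)"
  have "wf_fm ?D" using OrE.hyps(1) OrE.prems by (auto dest: derives_wf)
  then have "insert ?D (ntrans \<chi> ` \<Gamma>) \<tturnstile> ntrans \<chi> \<theta>"
    by (rule derives.OrE[OF hyp_insert OrE.IH(2,3)[OF OrE.prems, THEN derives_mono]]) auto
  then show ?case using OrE.IH(1)[OF OrE.prems] by (auto intro: ntrans_bind)
next
  case (ImpI \<phi> \<Gamma> \<psi>)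
  then show ?case by (simp add: derives.ImpI)
next
  case (ImpE \<Gamma> \<phi> \<psi>)
  from ImpE.IH[OF ImpE.prems] show ?case unfolding ntrans.simps by (rule derives.ImpE)
next
  case (AllI \<Gamma> \<phi>)
  from AllI.IH[of "lift \<chi>"] AllI.prems show ?case
    by (auto intro!: derives.AllI simp: image_image lift_ntrans)
next
  case (AllE \<Gamma> \<phi> t)
  from derives.AllE[OF AllE.IH[OF AllE.prems, unfolded ntrans.simps] AllE.hyps(2)] show ?case
    by (simp add: inst_ntrans)
next
  case (ExI \<Gamma> t \<phi>)
  from ExI.IH[OF ExI.prems] have "ntrans \<chi> ` \<Gamma> \<tturnstile> inst t (ntrans (lift \<chi>) \<phi>)"
    by (simp add: inst_ntrans)
  then show ?case using ExI.hyps ExI.prems by (auto intro!: dnegI derives.ExI)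
next
  case (ExE \<Gamma> \<phi> \<psi>)
  let ?D = "Ex (ntrans (lift \<chi>) \<phi>)"
  have wf: "wf_fm ?D" using ExE.hyps(1) ExE.prems by (auto dest: derives_wf)
  have "insert (ntrans (lift \<chi>) \<phi>) (lift ` ntrans \<chi> ` \<Gamma>) \<tturnstile> lift (ntrans \<chi> \<psi>)"
    using ExE.IH(2)[of "lift \<chi>"] ExE.prems by (simp add: image_image lift_ntrans)
  then have "insert ?D (ntrans \<chi> ` \<Gamma>) \<tturnstile> ntrans \<chi> \<psi>"
    using wf by (rule_tac derives.ExE[OF hyp_insert]) (auto elim!: derives_mono)
  then show ?case using ExE.IH(1)[OF ExE.prems] by (auto intro: ntrans_bind)
next
  case (EqI t \<Gamma>)
  then show ?case by (auto intro!: dnegI derives.EqI)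
next
  case (EqE \<Gamma> s t \<phi>)
  have wf: "wf_fm (Eq s t)" using EqE.hyps(1) by (rule derives_wf)
  have "insert (Eq s t) (ntrans \<chi> ` \<Gamma>) \<tturnstile> inst s (ntrans (lift \<chi>) \<phi>)"
    using EqE.IH(2)[OF EqE.prems] by (auto intro: weaken simp: inst_ntrans)
  then have "insert (Eq s t) (ntrans \<chi> ` \<Gamma>) \<tturnstile> inst t (ntrans (lift \<chi>) \<phi>)"
    using wf EqE.hyps EqE.prems by (rule_tac derives.EqE[OF hyp_insert]) auto
  then show ?case using EqE.IH(1)[OF EqE.prems] by (auto intro: ntrans_bind simp: inst_ntrans)
qed

end

section \<open>Prenex normal forms and decidable formulas\<close>

text \<open>Quantifier-free components contribute only the empty path, so the case distinction in
  \<open>Alt\<close> agrees with the general clause.\<close>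

lemma Alt_Bool:
  "Alt (And \<phi> \<psi>) = Alt \<phi> \<union> Alt \<psi>"
  "Alt (Or \<phi> \<psi>) = Alt \<phi> \<union> Alt \<psi>"
  "Alt (Imp \<phi> \<psi>) = map opposite ` Alt \<phi> \<union> Alt \<psi>"
proof -
  have "qfree \<theta> \<Longrightarrow> Alt \<theta> = {[]}" for \<theta>
    by (cases \<theta>) auto
  then show "Alt (And \<phi> \<psi>) = Alt \<phi> \<union> Alt \<psi>" "Alt (Or \<phi> \<psi>) = Alt \<phi> \<union> Alt \<psi>"
    "Alt (Imp \<phi> \<psi>) = map opposite ` Alt \<phi> \<union> Alt \<psi>"
    by auto
qed

lemma Alt_nonempty: "Alt \<phi> \<noteq> {}"
proof (induction \<phi>)
  case (All \<phi>)
  then obtain s where "s \<in> Alt \<phi>" by auto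
  then show ?case by (cases "init s = Some Minus") auto
next
  case (Ex \<phi>)
  then obtain s where "s \<in> Alt \<phi>" by auto
  then show ?case by (cases "init s = Some Plus") auto
qed auto

lemma finite_Alt: "finite (Alt \<phi>)"
  by (induction \<phi>) auto

text \<open>The maximum in \<open>deg\<close> can be unfolded because \<open>Alt \<phi>\<close> is
  finite and nonempty.\<close>

lemma F_plus_iff: "\<phi> \<in> F_plus k \<longleftrightarrow> (\<forall>s \<in> Alt \<phi>. length s \<le> k)"
  by (simp add: F_plus_def deg_def finite_Alt Alt_nonempty)

lemma init_opposite: "init (map opposite s) = map_option opposite (init s)"
  by (cases s) (auto simp: init_def)

text \<open>\<open>paths_below j Plus\<close> and \<open>paths_below j Minus\<close> are the classes of formulas that are
  classically \<open>\<Sigma>\<^sub>j\<close> and \<open>\<Pi>\<^sub>j\<close>, respectively, by pulling quantifiers to the front.\<close>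

definition paths_below :: "nat \<Rightarrow> sign \<Rightarrow> fm \<Rightarrow> bool" where
  "paths_below j a \<phi> \<longleftrightarrow> (\<forall>s \<in> Alt \<phi>. length s < j \<or> length s = j \<and> init s \<noteq> Some (opposite a))"

lemma paths_below_length: "paths_below j a \<phi> \<Longrightarrow> \<forall>s \<in> Alt \<phi>. length s \<le> j"
  by (auto simp: paths_below_def)

lemma opposite_opposite [simp]: "opposite (opposite a) = a"
  by (cases a) auto

lemma opposite_eq_iff [simp]: "opposite a = opposite b \<longleftrightarrow> a = b"
  by (cases a; cases b) auto

lemma opposite_neq [simp]: "opposite a \<noteq> a" "a \<noteq> opposite a"
  by (cases a; auto)+

lemma paths_below_Bool:
  "paths_below j a (And \<phi> \<psi>) \<longleftrightarrow> paths_below j a \<phi> \<and> paths_below j a \<psi>"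
  "paths_below j a (Or \<phi> \<psi>) \<longleftrightarrow> paths_below j a \<phi> \<and> paths_below j a \<psi>"
  "paths_below j a (Imp \<phi> \<psi>) \<longleftrightarrow> paths_below j (opposite a) \<phi> \<and> paths_below j a \<psi>"
proof -
  have "map_option opposite x = Some (opposite a) \<longleftrightarrow> x = Some a" for x
    by (cases x) auto
  then show "paths_below j a (Imp \<phi> \<psi>) \<longleftrightarrow> paths_below j (opposite a) \<phi> \<and> paths_below j a \<psi>"
    unfolding paths_below_def Alt_Bool by (auto simp: init_opposite ball_Un)
qed (auto simp: paths_below_def Alt_Bool simp del: Alt.simps)

text \<open>Indexing the quantifiers by signs lets dual prenexing arguments be carried out
  once.\<close>

definition quant :: "sign \<Rightarrow> fm \<Rightarrow> fm" where
  "quant a = (case a of Plus \<Rightarrow> Ex | Minus \<Rightarrow> All)"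

lemma quant_simps [simp]: "quant Plus = Ex" "quant Minus = All"
  by (simp_all add: quant_def)

lemma Alt_quant: "Alt (quant a \<phi>) = {s \<in> Alt \<phi>. init s = Some a}
     \<union> {a # s | s. s \<in> Alt \<phi> \<and> init s \<noteq> Some a}"
  by (cases a) auto

lemma init_Alt_quant: "s \<in> Alt (quant a \<phi>) \<Longrightarrow> init s = Some a"
  by (auto simp: Alt_quant init_def)

text \<open>Every path of \<open>quant a \<phi>\<close> starts with \<open>a\<close>, so a bound on
  length already fixes the sign. A path of \<open>\<phi>\<close> starting with \<open>a\<close> is
  kept, and any other is lengthened by one, hence was shorter than \<open>j\<close>.\<close>

lemma paths_below_quant:
  assumes "\<forall>s \<in> Alt (quant a \<phi>). length s \<le> j"
  shows "j > 0 \<and> paths_below j a \<phi> \<and> paths_below j a (quant a \<phi>)"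
proof (intro conjI)
  obtain s where s: "s \<in> Alt (quant a \<phi>)" using Alt_nonempty by blast
  then show "j > 0" using assms init_Alt_quant[OF s] by (cases s) (auto simp: init_def)
  show "paths_below j a (quant a \<phi>)"
    using assms init_Alt_quant by (fastforce simp: paths_below_def)
  show "paths_below j a \<phi>"
    unfolding paths_below_def
  proof
    fix s assume "s \<in> Alt \<phi>"
    then have "init s = Some a \<Longrightarrow> s \<in> Alt (quant a \<phi>)"
      and "init s \<noteq> Some a \<Longrightarrow> a # s \<in> Alt (quant a \<phi>)"
      by (auto simp: Alt_quant)
    with assms show "length s < j \<or> length s = j \<and> init s \<noteq> Some (opposite a)"
      by (cases "init s = Some a") fastforce+
  qed
qed

text \<open>The paths start with \<open>a\<close>, which the opposite class forbids at length
  exactly \<open>j\<close>; hence all of them are strictly shorter.\<close>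

lemma paths_below_quant_opposite:
  assumes "paths_below j (opposite a) (quant a \<phi>)"
  shows "\<exists>i. j = Suc i \<and> (\<forall>s \<in> Alt (quant a \<phi>). length s \<le> i)"
proof -
  have less: "\<forall>s \<in> Alt (quant a \<phi>). length s < j"
    using assms init_Alt_quant by (fastforce simp: paths_below_def)
  moreover have "j > 0" using less Alt_nonempty[of "quant a \<phi>"] by fastforce
  ultimately show ?thesis by (cases j) auto
qed

lemma wf_quant [simp]: "wf_fm (quant a \<phi>) = wf_fm \<phi>"
  by (cases a) auto

lemma wf_quant_pow [simp]: "wf_fm ((quant a ^^ n) \<phi>) = wf_fm \<phi>"
  by (induction n) auto

fun prenex :: "sign \<Rightarrow> nat \<Rightarrow> fm set" where
  "prenex Plus j = Sigma_fm j"
| "prenex Minus j = Pi_fm j"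

lemma prenex_0: "prenex a 0 = {\<phi>. qfree \<phi>}"
  by (cases a) auto

lemma prenex_Suc: "prenex a (Suc j) = {(quant a ^^ n) \<phi> | n \<phi>. n \<ge> 1 \<and> \<phi> \<in> prenex (opposite a) j}"
  by (cases a) auto

lemma lift_prenex: "\<phi> \<in> prenex a j \<Longrightarrow> lift \<phi> \<in> prenex a j"
  using subst_Sigma_Pi by (cases a) (auto simp: lift_def)

section \<open>Provable equivalence and decidability in the base theory\<close>

context semiclassical
begin

lemma AndL: "And \<phi> \<psi> \<in> \<Gamma> \<Longrightarrow> wf_fm \<phi> \<Longrightarrow> wf_fm \<psi> \<Longrightarrow> insert \<phi> (insert \<psi> \<Gamma>) \<tturnstile> \<chi> \<Longrightarrow> \<Gamma> \<tturnstile> \<chi>"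
  by (metis cut derives.AndE1 derives.AndE2 derives.hyp weaken wf_fm.simps(3))

lemma OrL: "Or \<phi> \<psi> \<in> \<Gamma> \<Longrightarrow> wf_fm \<phi> \<Longrightarrow> wf_fm \<psi> \<Longrightarrow> insert \<phi> \<Gamma> \<tturnstile> \<chi> \<Longrightarrow> insert \<psi> \<Gamma> \<tturnstile> \<chi> \<Longrightarrow> \<Gamma> \<tturnstile> \<chi>"
  by (rule derives.OrE[OF derives.hyp, of \<phi> \<psi>]) auto

lemma ImpL: "Imp \<phi> \<psi> \<in> \<Gamma> \<Longrightarrow> wf_fm \<psi> \<Longrightarrow> \<Gamma> \<tturnstile> \<phi> \<Longrightarrow> \<Gamma> \<tturnstile> \<psi>"
  by (rule derives.ImpE[OF derives.hyp]) (auto dest: derives_wf)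

lemma NegL: "Neg \<phi> \<in> \<Gamma> \<Longrightarrow> wf_fm \<chi> \<Longrightarrow> \<Gamma> \<tturnstile> \<phi> \<Longrightarrow> \<Gamma> \<tturnstile> \<chi>"
  by (rule derives.BotE[OF ImpL]) auto

lemma ExL: "Ex \<phi> \<in> \<Gamma> \<Longrightarrow> wf_fm \<phi> \<Longrightarrow> insert \<phi> (lift ` \<Gamma>) \<tturnstile> lift \<chi> \<Longrightarrow> \<Gamma> \<tturnstile> \<chi>"
  by (rule derives.ExE[OF derives.hyp]) auto

lemma AllL: "All \<phi> \<in> \<Gamma> \<Longrightarrow> wf_fm \<phi> \<Longrightarrow> lift ` \<Gamma> \<tturnstile> \<phi>"
  by (rule AllE_lift, rule derives.hyp) auto

lemma AllL': "lift (All \<phi>) \<in> \<Gamma> \<Longrightarrow> wf_fm \<phi> \<Longrightarrow> \<Gamma> \<tturnstile> \<phi>"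
  by (rule AllE_lift, rule derives.hyp) auto

text \<open>The absence of hypotheses makes equivalences survive lifting, so that they can be used
  under quantifiers.\<close>

definition equivT :: "fm \<Rightarrow> fm \<Rightarrow> bool" where
  "equivT \<phi> \<psi> \<longleftrightarrow> {} \<tturnstile> Imp \<phi> \<psi> \<and> {} \<tturnstile> Imp \<psi> \<phi>"

definition decT :: "fm \<Rightarrow> bool" where
  "decT \<phi> \<longleftrightarrow> {} \<tturnstile> Or \<phi> (Neg \<phi>)"

lemma equivT_wf: "equivT \<phi> \<psi> \<Longrightarrow> wf_fm \<phi> \<and> wf_fm \<psi>"
  unfolding equivT_def by (auto dest: derives_wf)

lemma equivTI: "{\<phi>} \<tturnstile> \<psi> \<Longrightarrow> {\<psi>} \<tturnstile> \<phi> \<Longrightarrow> equivT \<phi> \<psi>"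
  unfolding equivT_def by (meson derives.ImpI derives_wf)

lemma equivTD1: "equivT \<phi> \<psi> \<Longrightarrow> \<Gamma> \<tturnstile> \<phi> \<Longrightarrow> \<Gamma> \<tturnstile> \<psi>"
  unfolding equivT_def by (meson derives.ImpE weaken_empty)

lemma equivTD2: "equivT \<phi> \<psi> \<Longrightarrow> \<Gamma> \<tturnstile> \<psi> \<Longrightarrow> \<Gamma> \<tturnstile> \<phi>"
  unfolding equivT_def by (meson derives.ImpE weaken_empty)

lemma equivT_sym: "equivT \<phi> \<psi> \<Longrightarrow> equivT \<psi> \<phi>"
  by (simp add: equivT_def)

lemma equivT_refl: "wf_fm \<phi> \<Longrightarrow> equivT \<phi> \<phi>"
  by (intro equivTI hyp_insert)

lemma equivT_trans: "equivT \<phi> \<psi> \<Longrightarrow> equivT \<psi> \<theta> \<Longrightarrow> equivT \<phi> \<theta>"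
  by (meson equivTI equivTD1 equivTD2 hyp_insert equivT_wf)

lemma equivT_lift: "equivT \<phi> \<psi> \<Longrightarrow> equivT (lift \<phi>) (lift \<psi>)"
  unfolding equivT_def using lift_entails[of "{}"] by force

lemma decT_wf: "decT \<phi> \<Longrightarrow> wf_fm \<phi>"
  unfolding decT_def by (auto dest: derives_wf)

lemma decT_cases: "decT \<phi> \<Longrightarrow> insert \<phi> \<Gamma> \<tturnstile> \<chi> \<Longrightarrow> insert (Neg \<phi>) \<Gamma> \<tturnstile> \<chi> \<Longrightarrow> \<Gamma> \<tturnstile> \<chi>"
  unfolding decT_def by (rule derives.OrE[OF weaken_empty])

lemma Imp_mono:
  assumes "\<And>\<Gamma>. \<Gamma> \<tturnstile> \<phi>' \<Longrightarrow> \<Gamma> \<tturnstile> \<phi>" "\<And>\<Gamma>. \<Gamma> \<tturnstile> \<psi> \<Longrightarrow> \<Gamma> \<tturnstile> \<psi>'"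
    and "wf_fm \<phi>" "wf_fm \<phi>'" "wf_fm \<psi>"
  shows "{Imp \<phi> \<psi>} \<tturnstile> Imp \<phi>' \<psi>'"
  using assms by (intro derives.ImpI assms(2) ImpL[of \<phi> \<psi>] assms(1) hyp_insert) auto

lemma equivT_Imp:
  assumes "equivT \<phi> \<phi>'" and "equivT \<psi> \<psi>'"
  shows "equivT (Imp \<phi> \<psi>) (Imp \<phi>' \<psi>')"
  using assms[THEN equivT_wf] equivTD1[OF assms(1)] equivTD1[OF assms(2)]
    equivTD2[OF assms(1)] equivTD2[OF assms(2)]
  by (intro equivTI Imp_mono) simp_all

lemma equivT_Neg: "equivT \<phi> \<psi> \<Longrightarrow> equivT (Neg \<phi>) (Neg \<psi>)"
  by (simp add: equivT_Imp equivT_refl)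

lemma equivT_And:
  assumes "equivT \<phi> \<phi>'" and "equivT \<psi> \<psi>'"
  shows "equivT (And \<phi> \<psi>) (And \<phi>' \<psi>')"
proof (rule equivTI)
  note wf = assms[THEN equivT_wf]
  show "{And \<phi> \<psi>} \<tturnstile> And \<phi>' \<psi>'"
    using wf by (rule_tac AndL[of \<phi> \<psi>], simp_all, rule_tac derives.AndI)
      (auto intro: equivTD1[OF assms(1)] equivTD1[OF assms(2)] derives.hyp)
  show "{And \<phi>' \<psi>'} \<tturnstile> And \<phi> \<psi>"
    using wf by (rule_tac AndL[of \<phi>' \<psi>'], simp_all, rule_tac derives.AndI)
      (auto intro: equivTD2[OF assms(1)] equivTD2[OF assms(2)] derives.hyp)
qed

lemma equivT_Or:
  assumes "equivT \<phi> \<phi>'" and "equivT \<psi> \<psi>'"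
  shows "equivT (Or \<phi> \<psi>) (Or \<phi>' \<psi>')"
proof (rule equivTI)
  note wf = assms[THEN equivT_wf]
  show "{Or \<phi> \<psi>} \<tturnstile> Or \<phi>' \<psi>'"
    using wf by (rule_tac OrL[of \<phi> \<psi>]) (auto intro: derives.OrI1[OF equivTD1[OF assms(1) hyp_insert]]
        derives.OrI2[OF equivTD1[OF assms(2) hyp_insert]])
  show "{Or \<phi>' \<psi>'} \<tturnstile> Or \<phi> \<psi>"
    using wf by (rule_tac OrL[of \<phi>' \<psi>']) (auto intro: derives.OrI1[OF equivTD2[OF assms(1) hyp_insert]]
        derives.OrI2[OF equivTD2[OF assms(2) hyp_insert]])
qed

lemma equivT_And_commute: "wf_fm \<phi> \<Longrightarrow> wf_fm \<psi> \<Longrightarrow> equivT (And \<phi> \<psi>) (And \<psi> \<phi>)"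
  by (rule equivTI; rule AndL[OF singletonI]; (rule derives.AndI)?) (auto intro: derives.hyp)

lemma equivT_Or_commute: "wf_fm \<phi> \<Longrightarrow> wf_fm \<psi> \<Longrightarrow> equivT (Or \<phi> \<psi>) (Or \<psi> \<phi>)"
  by (rule equivTI; rule OrL[OF singletonI])
    (auto intro: derives.OrI1[OF hyp_insert] derives.OrI2[OF hyp_insert])

lemma equivT_quant:
  assumes "equivT \<phi> \<psi>"
  shows "equivT (quant a \<phi>) (quant a \<psi>)"
proof -
  have E: "{Ex \<phi>} \<tturnstile> Ex \<psi>" if "equivT \<phi> \<psi>" for \<phi> \<psi>
    using equivT_wf[OF that]
    by (rule_tac ExL[of \<phi>]) (auto intro!: ExI_lift equivTD1[OF that] hyp_insert)
  have A: "{All \<phi>} \<tturnstile> All \<psi>" if "equivT \<phi> \<psi>" for \<phi> \<psi>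
    using equivT_wf[OF that] by (rule_tac derives.AllI[OF equivTD1[OF that AllL]]) auto
  show ?thesis
    using E A assms equivT_sym[OF assms] by (cases a) (auto intro!: equivTI)
qed

text \<open>Vacuous quantifiers fill the blocks that \<open>Sigma_fm\<close> and
  \<open>Pi_fm\<close> require to be nonempty; \<open>Zero\<close> is the witness or
  instance.\<close>

lemma equivT_dummy: "wf_fm \<phi> \<Longrightarrow> equivT \<phi> (quant a (lift \<phi>))"
proof (cases a)
  case Plus
  assume wf: "wf_fm \<phi>"
  have "{\<phi>} \<tturnstile> Ex (lift \<phi>)"
    using wf by (intro derives.ExI[of _ _ Zero]) (auto intro: hyp_insert)
  moreover have "{Ex (lift \<phi>)} \<tturnstile> \<phi>"
    using wf by (rule_tac ExL[of "lift \<phi>"]) (auto intro: hyp_insert)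
  ultimately show ?thesis using Plus by (auto intro: equivTI)
next
  case Minus
  assume wf: "wf_fm \<phi>"
  have "{\<phi>} \<tturnstile> All (lift \<phi>)"
    using wf by (intro derives.AllI) (auto intro: hyp_insert)
  moreover have "{All (lift \<phi>)} \<tturnstile> \<phi>"
    using wf derives.AllE[OF hyp_insert, of "lift \<phi>" Zero "{}"] by simp
  ultimately show ?thesis using Minus by (auto intro: equivTI)
qed

lemma decT_equivT: "equivT \<phi> \<psi> \<Longrightarrow> decT \<psi> \<Longrightarrow> decT \<phi>"
  using equivTD2[OF equivT_Or[OF _ equivT_Imp[OF _ equivT_refl]], of \<phi> \<psi> \<phi> \<psi> Bot "{}"]
  by (simp add: decT_def)

lemma decT_Neg:
  assumes "decT \<phi>"
  shows "decT (Neg \<phi>)"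
  unfolding decT_def[of "Neg \<phi>"]
proof (rule decT_cases[OF assms])
  have wf: "wf_fm \<phi>" using assms by (rule decT_wf)
  have "{Neg \<phi>, \<phi>} \<tturnstile> Bot"
    using wf by (intro NegL[of \<phi> _ Bot] derives.hyp) auto
  then show "{\<phi>} \<tturnstile> Or (Neg \<phi>) (Neg (Neg \<phi>))"
    using wf by (intro derives.OrI2 derives.ImpI) auto
  show "{Neg \<phi>} \<tturnstile> Or (Neg \<phi>) (Neg (Neg \<phi>))"
    using wf by (intro derives.OrI1 hyp_insert) auto
qed

lemma decT_And: "decT \<phi> \<Longrightarrow> decT \<psi> \<Longrightarrow> decT (And \<phi> \<psi>)"
proof -
  assume d: "decT \<phi>" "decT \<psi>"
  note wf = d[THEN decT_wf]
  have "{\<psi>, \<phi>} \<tturnstile> And \<phi> \<psi>" using wf by (intro derives.AndI) (auto intro: derives.hyp)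
  moreover have "{Neg \<psi>, \<phi>} \<tturnstile> Neg (And \<phi> \<psi>)"
    using wf by (intro derives.ImpI, rule_tac AndL[of \<phi> \<psi>], simp_all, rule_tac NegL[of \<psi>]) (auto intro: derives.hyp)
  moreover have "{Neg \<phi>} \<tturnstile> Neg (And \<phi> \<psi>)"
    using wf by (intro derives.ImpI, rule_tac AndL[of \<phi> \<psi>], simp_all, rule_tac NegL[of \<phi>]) (auto intro: derives.hyp)
  ultimately show ?thesis
    unfolding decT_def using wf
    by (rule_tac decT_cases[OF d(1)], rule_tac decT_cases[OF d(2)]) (auto intro: derives.OrI1 derives.OrI2)
qed

lemma decT_Or: "decT \<phi> \<Longrightarrow> decT \<psi> \<Longrightarrow> decT (Or \<phi> \<psi>)"
proof -
  assume d: "decT \<phi>" "decT \<psi>"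
  note wf = d[THEN decT_wf]
  have "{\<phi>} \<tturnstile> Or \<phi> \<psi>" "{\<psi>, Neg \<phi>} \<tturnstile> Or \<phi> \<psi>"
    using wf by (auto intro: derives.OrI1[OF hyp_insert] derives.OrI2[OF hyp_insert])
  moreover have "{Neg \<psi>, Neg \<phi>} \<tturnstile> Neg (Or \<phi> \<psi>)"
  proof (rule derives.ImpI)
    show "{Or \<phi> \<psi>, Neg \<psi>, Neg \<phi>} \<tturnstile> Bot"
    proof (rule OrL[of \<phi> \<psi>])
      show "insert \<phi> {Or \<phi> \<psi>, Neg \<psi>, Neg \<phi>} \<tturnstile> Bot"
        using wf by (rule_tac NegL[of \<phi>]) (auto intro: derives.hyp)
      show "insert \<psi> {Or \<phi> \<psi>, Neg \<psi>, Neg \<phi>} \<tturnstile> Bot"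
        using wf by (rule_tac NegL[of \<psi>]) (auto intro: derives.hyp)
    qed (use wf in auto)
  qed (use wf in auto)
  ultimately show ?thesis
    unfolding decT_def[of "Or \<phi> \<psi>"] using wf
    by (rule_tac decT_cases[OF d(1)], simp_all add: derives.OrI1, rule_tac decT_cases[OF d(2)])
      (auto intro: derives.OrI1 derives.OrI2)
qed

text \<open>Deciding the antecedent reduces the prenexing of implications to negation and
  disjunction.\<close>

lemma equivT_Imp_Or: "decT \<phi> \<Longrightarrow> wf_fm \<psi> \<Longrightarrow> equivT (Imp \<phi> \<psi>) (Or (Neg \<phi>) \<psi>)"
proof (rule equivTI)
  assume d: "decT \<phi>" and wf: "wf_fm \<psi>"
  note wf = wf decT_wf[OF d]
  show "{Imp \<phi> \<psi>} \<tturnstile> Or (Neg \<phi>) \<psi>"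
  proof (rule decT_cases[OF d])
    have "{\<phi>, Imp \<phi> \<psi>} \<tturnstile> \<psi>"
      using wf by (rule_tac ImpL[of \<phi>]) (auto intro: derives.hyp)
    then show "{\<phi>, Imp \<phi> \<psi>} \<tturnstile> Or (Neg \<phi>) \<psi>"
      using wf by (intro derives.OrI2) auto
    show "{Neg \<phi>, Imp \<phi> \<psi>} \<tturnstile> Or (Neg \<phi>) \<psi>"
      using wf by (intro derives.OrI1 hyp_insert) auto
  qed
  show "{Or (Neg \<phi>) \<psi>} \<tturnstile> Imp \<phi> \<psi>"
  proof (rule derives.ImpI)
    have "{Neg \<phi>, \<phi>, Or (Neg \<phi>) \<psi>} \<tturnstile> \<psi>"
      using wf by (rule_tac NegL[of \<phi>]) (auto intro: derives.hyp)
    then show "{\<phi>, Or (Neg \<phi>) \<psi>} \<tturnstile> \<psi>"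
      using wf by (rule_tac OrL[of "Neg \<phi>" \<psi>]) (auto intro: hyp_insert)
  qed (use wf in auto)
qed

lemma decT_Imp: "decT \<phi> \<Longrightarrow> decT \<psi> \<Longrightarrow> decT (Imp \<phi> \<psi>)"
  by (meson equivT_Imp_Or decT_equivT decT_Or decT_Neg decT_wf)


section \<open>Prenex classes up to provable equivalence\<close>

definition up_to :: "fm set \<Rightarrow> fm set" where
  "up_to C = {\<phi>. \<exists>\<psi> \<in> C. equivT \<phi> \<psi>}"

lemma up_to_equivT: "equivT \<phi> \<psi> \<Longrightarrow> \<psi> \<in> up_to C \<Longrightarrow> \<phi> \<in> up_to C"
  by (auto simp: up_to_def intro: equivT_trans)

lemma up_to_wf: "\<phi> \<in> up_to C \<Longrightarrow> wf_fm \<phi>"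
  by (auto simp: up_to_def dest: equivT_wf)

lemma up_to_refl: "\<phi> \<in> C \<Longrightarrow> wf_fm \<phi> \<Longrightarrow> \<phi> \<in> up_to C"
  by (auto simp: up_to_def intro: equivT_refl)

lemma up_to_lift: "\<phi> \<in> up_to (prenex a j) \<Longrightarrow> lift \<phi> \<in> up_to (prenex a j)"
  by (auto simp: up_to_def intro: equivT_lift lift_prenex)

lemma up_to_quant:
  assumes "\<phi> \<in> up_to (prenex a (Suc j))"
  shows "quant a \<phi> \<in> up_to (prenex a (Suc j))"
proof -
  from assms obtain n \<psi> where *: "equivT \<phi> ((quant a ^^ n) \<psi>)" "\<psi> \<in> prenex (opposite a) j"
    by (auto simp: up_to_def prenex_Suc)
  then have "equivT (quant a \<phi>) ((quant a ^^ Suc n) \<psi>)" by (simp add: equivT_quant)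
  with *(2) show ?thesis unfolding up_to_def prenex_Suc by fastforce
qed

lemma up_to_quant_pow:
  "\<phi> \<in> up_to (prenex a (Suc j)) \<Longrightarrow> (quant a ^^ n) \<phi> \<in> up_to (prenex a (Suc j))"
  by (induction n) (auto intro: up_to_quant)

lemma up_to_opposite_Suc:
  assumes "\<phi> \<in> up_to (prenex (opposite a) j)"
  shows "\<phi> \<in> up_to (prenex a (Suc j))"
proof -
  from assms obtain \<psi> where *: "equivT \<phi> \<psi>" "\<psi> \<in> prenex (opposite a) j"
    by (auto simp: up_to_def)
  then have "equivT \<phi> ((quant a ^^ 1) (lift \<psi>))"
    using equivT_trans equivT_dummy equivT_wf by fastforce
  with lift_prenex[OF *(2)] show ?thesis unfolding up_to_def prenex_Suc by fastforce
qed

text \<open>The dummy quantifier goes innermost: the matrix rises one level by induction, and the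
  outer block is put back. At level 0 both signs give the quantifier-free formulas, so
  \<open>up_to_opposite_Suc\<close> suffices.\<close>

lemma up_to_Suc: "\<phi> \<in> up_to (prenex a j) \<Longrightarrow> \<phi> \<in> up_to (prenex a (Suc j))"
proof (induction j arbitrary: a \<phi>)
  case 0
  then show ?case using up_to_opposite_Suc[of \<phi> a 0] by (simp add: prenex_0)
next
  case (Suc j)
  then obtain n \<psi> where *: "equivT \<phi> ((quant a ^^ n) \<psi>)" "\<psi> \<in> prenex (opposite a) j"
    by (auto simp: up_to_def prenex_Suc)
  then have "\<psi> \<in> up_to (prenex (opposite a) j)"
    using equivT_wf by (intro up_to_refl) fastforce+
  then have "(quant a ^^ n) \<psi> \<in> up_to (prenex a (Suc (Suc j)))"
    by (intro up_to_quant_pow up_to_opposite_Suc Suc.IH)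
  then show ?case using * up_to_equivT by blast
qed

lemma up_to_mono: "\<phi> \<in> up_to (prenex a i) \<Longrightarrow> i \<le> j \<Longrightarrow> \<phi> \<in> up_to (prenex a j)"
  by (rotate_tac, induction j rule: dec_induct) (auto intro: up_to_Suc)

text \<open>This is induction on the length of the outer quantifier block, with the matrix in the
  lower class of opposite sign as base case.\<close>

lemma up_to_prenex_induct [consumes 1, case_names base step cong]:
  assumes "\<phi> \<in> up_to (prenex a (Suc j))"
    and base: "\<And>\<psi>. \<psi> \<in> up_to (prenex (opposite a) j) \<Longrightarrow> P \<psi>"
    and step: "\<And>\<psi>. \<psi> \<in> up_to (prenex a (Suc j)) \<Longrightarrow> P \<psi> \<Longrightarrow> P (quant a \<psi>)"
    and cong: "\<And>\<psi> \<theta>. equivT \<psi> \<theta> \<Longrightarrow> P \<theta> \<Longrightarrow> P \<psi>"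
  shows "P \<phi>"
proof -
  from assms(1) obtain n \<psi> where *: "equivT \<phi> ((quant a ^^ n) \<psi>)" "\<psi> \<in> prenex (opposite a) j"
    by (auto simp: up_to_def prenex_Suc)
  then have \<psi>: "\<psi> \<in> up_to (prenex (opposite a) j)"
    using equivT_wf by (intro up_to_refl) fastforce+
  have "P ((quant a ^^ n) \<psi>)"
  proof (induction n)
    case 0
    then show ?case using base \<psi> by simp
  next
    case (Suc n)
    then show ?case using step up_to_quant_pow[OF up_to_opposite_Suc[OF \<psi>]] by simp
  qed
  then show ?thesis using cong * by blast
qed

section \<open>Decidability and negation of prenex formulas\<close>

text \<open>Dummy quantifiers raise the formula to level exactly \<open>k\<close>, where excluded
  middle is an axiom.\<close>

lemma decT_Sigma:
  assumes "\<phi> \<in> up_to (prenex Plus j)" and "j \<le> k"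
  shows "decT \<phi>"
proof -
  from up_to_mono[OF assms] obtain \<psi> where "equivT \<phi> \<psi>" "\<psi> \<in> Sigma_fm k"
    by (auto simp: up_to_def)
  moreover from this have "decT \<psi>"
    unfolding decT_def using equivT_wf
    by (intro derives.axiom) (auto simp: T_def LEM_def)
  ultimately show ?thesis by (blast intro: decT_equivT)
qed

lemma Neg_Ex: "wf_fm \<phi> \<Longrightarrow> equivT (Neg (Ex \<phi>)) (All (Neg \<phi>))"
proof (rule equivTI)
  assume wf: "wf_fm \<phi>"
  show "{Neg (Ex \<phi>)} \<tturnstile> All (Neg \<phi>)"
  proof (intro derives.AllI derives.ImpI)
    show "insert \<phi> (lift ` {Neg (Ex \<phi>)}) \<tturnstile> Bot"
      using wf by (rule_tac NegL[of "lift (Ex \<phi>)"]) (auto intro!: ExI_lift hyp_insert)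
  qed (use wf in auto)
  show "{All (Neg \<phi>)} \<tturnstile> Neg (Ex \<phi>)"
  proof (rule derives.ImpI)
    show "{Ex \<phi>, All (Neg \<phi>)} \<tturnstile> Bot"
    proof (rule ExL[of \<phi>])
      have "insert \<phi> (lift ` {Ex \<phi>, All (Neg \<phi>)}) \<tturnstile> Neg \<phi>"
        using wf by (rule_tac AllL') auto
      from derives.ImpE[OF this hyp_insert[OF wf]]
      show "insert \<phi> (lift ` {Ex \<phi>, All (Neg \<phi>)}) \<tturnstile> lift Bot" by simp
    qed (use wf in auto)
  qed (use wf in auto)
qed

lemma not_Ex_Neg_imp_All:
  assumes "decT \<phi>"
  shows "{Neg (Ex (Neg \<phi>))} \<tturnstile> All \<phi>"
proof (rule derives.AllI)
  have wf: "wf_fm \<phi>" using assms by (rule decT_wf)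
  show "lift ` {Neg (Ex (Neg \<phi>))} \<tturnstile> \<phi>"
  proof (rule decT_cases[OF assms])
    show "insert \<phi> (lift ` {Neg (Ex (Neg \<phi>))}) \<tturnstile> \<phi>" using wf by (rule hyp_insert)
    show "insert (Neg \<phi>) (lift ` {Neg (Ex (Neg \<phi>))}) \<tturnstile> \<phi>"
      using wf by (rule_tac NegL[of "lift (Ex (Neg \<phi>))"]) (auto intro!: ExI_lift hyp_insert)
  qed
qed

lemma Ex_Neg_imp_not_All: "wf_fm \<phi> \<Longrightarrow> {Ex (Neg \<phi>)} \<tturnstile> Neg (All \<phi>)"
proof (rule derives.ImpI)
  assume wf: "wf_fm \<phi>"
  show "{All \<phi>, Ex (Neg \<phi>)} \<tturnstile> Bot"
  proof (rule ExL[of "Neg \<phi>"])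
    have "insert (Neg \<phi>) (lift ` {All \<phi>, Ex (Neg \<phi>)}) \<tturnstile> \<phi>"
      using wf by (rule_tac AllL') auto
    then show "insert (Neg \<phi>) (lift ` {All \<phi>, Ex (Neg \<phi>)}) \<tturnstile> lift Bot"
      using wf by (rule_tac NegL[of \<phi>]) auto
  qed (use wf in auto)
qed auto

text \<open>It is decided whether a counterexample exists. One refutes the universal formula; if
  there is none, decidability of \<open>\<phi>\<close> gives every instance.\<close>

lemma decT_All:
  assumes "decT \<phi>" and "decT (Ex (Neg \<phi>))"
  shows "decT (All \<phi>)"
  unfolding decT_def
proof (rule decT_cases[OF assms(2)])
  note wf = decT_wf[OF assms(1)]
  show "{Ex (Neg \<phi>)} \<tturnstile> Or (All \<phi>) (Neg (All \<phi>))"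
    using wf by (intro derives.OrI2 Ex_Neg_imp_not_All) auto
  show "{Neg (Ex (Neg \<phi>))} \<tturnstile> Or (All \<phi>) (Neg (All \<phi>))"
    using wf by (intro derives.OrI1 not_Ex_Neg_imp_All assms(1)) auto
qed

lemma Neg_All:
  assumes "decT \<phi>" and "decT (Ex (Neg \<phi>))"
  shows "equivT (Neg (All \<phi>)) (Ex (Neg \<phi>))"
proof (rule equivTI)
  note wf = decT_wf[OF assms(1)]
  show "{Neg (All \<phi>)} \<tturnstile> Ex (Neg \<phi>)"
  proof (rule decT_cases[OF assms(2)])
    show "{Ex (Neg \<phi>), Neg (All \<phi>)} \<tturnstile> Ex (Neg \<phi>)" using wf by (auto intro: hyp_insert)
    have "{Neg (Ex (Neg \<phi>)), Neg (All \<phi>)} \<tturnstile> All \<phi>"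
      by (rule derives_mono[OF not_Ex_Neg_imp_All[OF assms(1)]]) auto
    then show "{Neg (Ex (Neg \<phi>)), Neg (All \<phi>)} \<tturnstile> Ex (Neg \<phi>)"
      using wf by (rule_tac NegL[of "All \<phi>"]) auto
  qed
  show "{Ex (Neg \<phi>)} \<tturnstile> Neg (All \<phi>)" using wf by (rule Ex_Neg_imp_not_All)
qed

lemma qfree_up_to: "qfree \<phi> \<Longrightarrow> wf_fm \<phi> \<Longrightarrow> \<phi> \<in> up_to (prenex a j)"
  by (rule up_to_mono[of _ _ 0]) (auto intro: up_to_refl simp: prenex_0)

text \<open>The two claims depend on each other: a universal formula is decided through the
  existence of a counterexample, and that statement lies in the Sigma class because the negated
  matrix already has prenex form.\<close>

lemma up_to_Neg_decT:
  "j \<le> k \<Longrightarrow> \<phi> \<in> up_to (prenex a j) \<Longrightarrow> decT \<phi> \<and> Neg \<phi> \<in> up_to (prenex (opposite a) j)"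
proof (induction j arbitrary: a \<phi>)
  case 0
  then obtain \<psi> where \<psi>: "equivT \<phi> \<psi>" "qfree \<psi>" by (auto simp: up_to_def prenex_0)
  then have "equivT (Neg \<phi>) (Neg \<psi>)" by (simp add: equivT_Neg)
  moreover have "Neg \<psi> \<in> up_to (prenex (opposite a) 0)"
    using \<psi> equivT_wf by (intro qfree_up_to) auto
  moreover have "decT \<phi>" using 0 decT_Sigma[of _ 0] by (simp add: prenex_0 up_to_def)
  ultimately show ?case by (auto intro: up_to_equivT)
next
  case (Suc j)
  have j: "j \<le> k" using Suc.prems by simp
  have dec: "decT \<psi>" if "\<psi> \<in> up_to (prenex Plus (Suc j))" for \<psi>
    using decT_Sigma that Suc.prems by blast
  have cong: "decT \<psi> \<and> Neg \<psi> \<in> up_to (prenex b (Suc j))"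
    if "equivT \<psi> \<theta>" "decT \<theta> \<and> Neg \<theta> \<in> up_to (prenex b (Suc j))" for \<psi> \<theta> b
    using that by (auto intro: decT_equivT up_to_equivT equivT_Neg)
  have base: "decT \<psi> \<and> Neg \<psi> \<in> up_to (prenex b (Suc j))" if "\<psi> \<in> up_to (prenex b j)" for \<psi> b
    using Suc.IH[OF j that] up_to_opposite_Suc by blast
  show ?case
    using Suc.prems(2)
  proof (induction rule: up_to_prenex_induct)
    case (base \<psi>)
    then show ?case by (rule \<open>\<And>\<psi> b. \<psi> \<in> up_to (prenex b j) \<Longrightarrow> _\<close>)
  next
    case (step \<psi>)
    then have wf: "wf_fm \<psi>" by (auto intro: up_to_wf)
    from step have "quant (opposite a) (Neg \<psi>) \<in> up_to (prenex (opposite a) (Suc j))"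
      by (auto intro: up_to_quant)
    moreover have "decT (quant a \<psi>) \<and> equivT (Neg (quant a \<psi>)) (quant (opposite a) (Neg \<psi>))"
    proof (cases a)
      case Plus
      then show ?thesis using step up_to_quant[of \<psi> a j] dec wf Neg_Ex by auto
    next
      case Minus
      \<comment> \<open>This formula is on the Sigma side at level \<open>Suc j\<close>, which is at
        most \<open>k\<close>; together with decidability of \<open>\<psi>\<close> it settles both
        claims about \<open>All \<psi>\<close>.\<close>
      then have "decT (Ex (Neg \<psi>))" using calculation dec by auto
      then show ?thesis using Minus step decT_All Neg_All by auto
    qed
    ultimately show ?case by (auto intro: up_to_equivT)
  next
    case (cong \<psi> \<theta>)
    then show ?case by (rule \<open>\<And>\<psi> \<theta> b. equivT \<psi> \<theta> \<Longrightarrow> _ \<Longrightarrow> decT \<psi> \<and> Neg \<psi> \<in> up_to (prenex b (Suc j))\<close>)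
  qed
qed

text \<open>Quantifiers are pulled out of one argument at a time, with commutativity supplying the
  other side. \<open>pull\<close> is restricted to side formulas of the class because for
  disjunction they must be decidable.\<close>

lemma up_to_op:
  fixes op :: "fm \<Rightarrow> fm \<Rightarrow> fm"
  assumes cong: "\<And>\<phi> \<phi>' \<psi> \<psi>'. equivT \<phi> \<phi>' \<Longrightarrow> equivT \<psi> \<psi>' \<Longrightarrow> equivT (op \<phi> \<psi>) (op \<phi>' \<psi>')"
    and comm: "\<And>\<phi> \<psi>. wf_fm \<phi> \<Longrightarrow> wf_fm \<psi> \<Longrightarrow> equivT (op \<phi> \<psi>) (op \<psi> \<phi>)"
    and pull: "\<And>\<phi> \<psi>. wf_fm \<phi> \<Longrightarrow> \<psi> \<in> up_to (prenex a (Suc j)) \<Longrightarrow>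
      equivT (op (quant a \<phi>) \<psi>) (quant a (op \<phi> (lift \<psi>)))"
    and base: "\<And>\<phi> \<psi>. \<phi> \<in> up_to (prenex (opposite a) j) \<Longrightarrow> \<psi> \<in> up_to (prenex (opposite a) j) \<Longrightarrow>
      op \<phi> \<psi> \<in> up_to (prenex (opposite a) j)"
    and "\<phi> \<in> up_to (prenex a (Suc j))" and "\<psi> \<in> up_to (prenex a (Suc j))"
  shows "op \<phi> \<psi> \<in> up_to (prenex a (Suc j))"
proof -
  \<comment> \<open>The first argument has no outer block left here; the block of the second is
    removed by swapping the arguments.\<close>
  have left: "op \<pi> \<psi> \<in> up_to (prenex a (Suc j))"
    if "\<psi> \<in> up_to (prenex a (Suc j))" "\<pi> \<in> up_to (prenex (opposite a) j)" for \<pi> \<psi>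
    using that
  proof (induction arbitrary: \<pi> rule: up_to_prenex_induct)
    case (base \<psi>)
    then show ?case by (intro up_to_opposite_Suc assms(4))
  next
    case (step \<psi>)
    have wf: "wf_fm \<psi>" "wf_fm \<pi>" using step up_to_wf by blast+
    have "op (lift \<pi>) \<psi> \<in> up_to (prenex a (Suc j))"
      using step by (auto intro: up_to_lift)
    then have "op \<psi> (lift \<pi>) \<in> up_to (prenex a (Suc j))"
      using comm[of \<psi> "lift \<pi>"] wf by (auto intro: up_to_equivT)
    \<comment> \<open>A dummy quantifier places \<open>\<pi>\<close> in the class that
      \<open>pull\<close> asks for.\<close>
    then have "op (quant a \<psi>) \<pi> \<in> up_to (prenex a (Suc j))"
      using pull[of \<psi> \<pi>] step.prems wf up_to_opposite_Suc by (auto intro: up_to_equivT up_to_quant)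
    then show ?case using comm[of \<pi> "quant a \<psi>"] wf by (auto intro: up_to_equivT)
  next
    case (cong \<psi> \<theta>)
    then show ?case using assms(1)[OF equivT_refl[OF up_to_wf], of \<pi>] by (blast intro: up_to_equivT)
  qed
  show ?thesis
    using assms(5,6)
  proof (induction arbitrary: \<psi> rule: up_to_prenex_induct)
    case (base \<pi>)
    then show ?case by (rule left[rotated])
  next
    case (step \<phi>)
    then have "op \<phi> (lift \<psi>) \<in> up_to (prenex a (Suc j))" by (auto intro: up_to_lift)
    then show ?case using pull[of \<phi> \<psi>] step up_to_wf by (blast intro: up_to_equivT up_to_quant)
  next
    case (cong \<phi> \<theta>)
    then show ?case using assms(1)[OF _ equivT_refl[OF up_to_wf], of \<phi> \<theta> \<psi>] by (blast intro: up_to_equivT)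
  qed
qed

section \<open>Quantifier extraction and prenex normal forms\<close>

lemma pull_And:
  assumes wf: "wf_fm \<phi>" "wf_fm \<psi>"
  shows "equivT (And (quant a \<phi>) \<psi>) (quant a (And \<phi> (lift \<psi>)))"
proof (cases a)
  case Plus
  have "{And (Ex \<phi>) \<psi>} \<tturnstile> Ex (And \<phi> (lift \<psi>))"
  proof (rule AndL[of "Ex \<phi>" \<psi>])
    show "{Ex \<phi>, \<psi>, And (Ex \<phi>) \<psi>} \<tturnstile> Ex (And \<phi> (lift \<psi>))"
      by (rule ExL[of \<phi>, OF _ _ ExI_lift[OF derives.AndI]]) (use wf in \<open>auto intro: derives.hyp\<close>)
  qed (use wf in auto)
  moreover have "{Ex (And \<phi> (lift \<psi>))} \<tturnstile> And (Ex \<phi>) \<psi>"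
  proof (rule ExL[OF singletonI])
    show "insert (And \<phi> (lift \<psi>)) (lift ` {Ex (And \<phi> (lift \<psi>))}) \<tturnstile> lift (And (Ex \<phi>) \<psi>)"
      by (rule AndL[OF insertI1])
        (use wf in \<open>auto intro!: derives.AndI ExI_lift intro: derives.hyp\<close>)
  qed (use wf in auto)
  ultimately show ?thesis using Plus by (auto intro: equivTI)
next
  case Minus
  have "{And (All \<phi>) \<psi>} \<tturnstile> All (And \<phi> (lift \<psi>))"
  proof (rule AndL[of "All \<phi>" \<psi>])
    show "{All \<phi>, \<psi>, And (All \<phi>) \<psi>} \<tturnstile> All (And \<phi> (lift \<psi>))"
      by (rule derives.AllI, rule derives.AndI, rule AllL) (use wf in \<open>auto intro: derives.hyp\<close>)
  qed (use wf in auto)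
  moreover have "{All (And \<phi> (lift \<psi>))} \<tturnstile> And (All \<phi>) \<psi>"
  proof (rule derives.AndI)
    have "lift ` {All (And \<phi> (lift \<psi>))} \<tturnstile> And \<phi> (lift \<psi>)" using wf by (intro AllL) auto
    then show "{All (And \<phi> (lift \<psi>))} \<tturnstile> All \<phi>" by (rule derives.AllI[OF derives.AndE1])
    \<comment> \<open>Any instance yields \<open>\<psi>\<close>, because the quantifier is vacuous
      there.\<close>
    have "{All (And \<phi> (lift \<psi>))} \<tturnstile> inst Zero (And \<phi> (lift \<psi>))"
      using wf by (rule_tac derives.AllE[OF hyp_insert]) auto
    then have "{All (And \<phi> (lift \<psi>))} \<tturnstile> And (inst Zero \<phi>) \<psi>"
      using inst_lift[of Zero \<psi>] by (simp add: inst_def)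
    then show "{All (And \<phi> (lift \<psi>))} \<tturnstile> \<psi>" by (rule derives.AndE2)
  qed
  ultimately show ?thesis using Minus by (auto intro: equivTI)
qed

text \<open>Pulling a universal quantifier out of a disjunction is the only part that goes beyond
  intuitionistic logic: to split the quantified disjunction, \<open>\<psi>\<close> is decided before
  the quantifier is instantiated.\<close>

lemma pull_Or:
  assumes wf: "wf_fm \<phi>" and dec: "decT \<psi>"
  shows "equivT (Or (quant a \<phi>) \<psi>) (quant a (Or \<phi> (lift \<psi>)))"
proof (cases a)
  note wf = wf decT_wf[OF dec]
  case Plus
  have "{Or (Ex \<phi>) \<psi>} \<tturnstile> Ex (Or \<phi> (lift \<psi>))"
  proof (rule OrL[of "Ex \<phi>" \<psi>])
    show "{Ex \<phi>, Or (Ex \<phi>) \<psi>} \<tturnstile> Ex (Or \<phi> (lift \<psi>))"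
      by (rule ExL[of \<phi>, OF _ _ ExI_lift[OF derives.OrI1]]) (use wf in \<open>auto intro: derives.hyp\<close>)
    have "{\<psi>, Or (Ex \<phi>) \<psi>} \<tturnstile> inst Zero (Or \<phi> (lift \<psi>))"
      using wf inst_lift[of Zero \<psi>] wf_inst[of \<phi> Zero] unfolding inst_def
      by (auto intro!: derives.OrI2[OF hyp_insert])
    then show "{\<psi>, Or (Ex \<phi>) \<psi>} \<tturnstile> Ex (Or \<phi> (lift \<psi>))"
      using wf by (intro derives.ExI[where t = Zero]) auto
  qed (use wf in auto)
  moreover have "{Ex (Or \<phi> (lift \<psi>))} \<tturnstile> Or (Ex \<phi>) \<psi>"
  proof (rule ExL[OF singletonI])
    let ?G = "insert (Or \<phi> (lift \<psi>)) (lift ` {Ex (Or \<phi> (lift \<psi>))})"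
    have "insert \<phi> ?G \<tturnstile> lift (Ex \<phi>)" using wf by (intro ExI_lift hyp_insert)
    then have "insert \<phi> ?G \<tturnstile> lift (Or (Ex \<phi>) \<psi>)" using wf by (auto intro: derives.OrI1)
    then show "?G \<tturnstile> lift (Or (Ex \<phi>) \<psi>)"
      using wf by (rule_tac OrL[OF insertI1]) (auto intro!: derives.OrI2[OF hyp_insert])
  qed (use wf in auto)
  ultimately show ?thesis using Plus by (auto intro: equivTI)
next
  note wf = wf decT_wf[OF dec]
  case Minus
  have "{Or (All \<phi>) \<psi>} \<tturnstile> All (Or \<phi> (lift \<psi>))"
  proof (rule OrL[of "All \<phi>" \<psi>])
    show "{All \<phi>, Or (All \<phi>) \<psi>} \<tturnstile> All (Or \<phi> (lift \<psi>))"
      by (rule derives.AllI, rule derives.OrI1, rule AllL) (use wf in auto)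
    show "{\<psi>, Or (All \<phi>) \<psi>} \<tturnstile> All (Or \<phi> (lift \<psi>))"
      by (rule derives.AllI, rule derives.OrI2) (use wf in \<open>auto intro: derives.hyp\<close>)
  qed (use wf in auto)
  moreover have "{All (Or \<phi> (lift \<psi>))} \<tturnstile> Or (All \<phi>) \<psi>"
  proof (rule decT_cases[OF dec])
    show "{\<psi>, All (Or \<phi> (lift \<psi>))} \<tturnstile> Or (All \<phi>) \<psi>"
      using wf by (auto intro: derives.OrI2[OF hyp_insert])
    let ?G = "{Neg \<psi>, All (Or \<phi> (lift \<psi>))}"
    have "lift ` ?G \<tturnstile> Or \<phi> (lift \<psi>)" using wf by (intro AllL) auto
    moreover have "insert (lift \<psi>) (lift ` ?G) \<tturnstile> \<phi>"
      using wf by (rule_tac NegL[of "lift \<psi>"]) (auto intro: hyp_insert)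
    ultimately have "lift ` ?G \<tturnstile> \<phi>"
      using wf by (rule_tac derives.OrE[OF _ hyp_insert]) auto
    then show "?G \<tturnstile> Or (All \<phi>) \<psi>"
      using wf by (intro derives.OrI1 derives.AllI)
  qed
  ultimately show ?thesis using Minus by (auto intro: equivTI)
qed

text \<open>The bound by \<open>k\<close> provides the decidability that \<open>pull_Or\<close>
  demands of the side formula.\<close>

lemma up_to_And_Or:
  assumes "j \<le> k" and "\<phi> \<in> up_to (prenex a j)" and "\<psi> \<in> up_to (prenex a j)"
  shows "And \<phi> \<psi> \<in> up_to (prenex a j) \<and> Or \<phi> \<psi> \<in> up_to (prenex a j)"
  using assms
proof (induction j arbitrary: a \<phi> \<psi>)
  case 0
  then obtain \<phi>' \<psi>' where *: "equivT \<phi> \<phi>'" "qfree \<phi>'" "equivT \<psi> \<psi>'" "qfree \<psi>'"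
    by (auto simp: up_to_def prenex_0)
  then have "And \<phi>' \<psi>' \<in> up_to (prenex a 0)" "Or \<phi>' \<psi>' \<in> up_to (prenex a 0)"
    using equivT_wf by (auto intro!: qfree_up_to)
  then show ?case using * by (auto intro: up_to_equivT equivT_And equivT_Or)
next
  case (Suc j)
  have dec: "decT \<theta>" if "\<theta> \<in> up_to (prenex a (Suc j))" for \<theta>
    using up_to_Neg_decT[OF Suc.prems(1) that] by simp
  have "And \<phi> \<psi> \<in> up_to (prenex a (Suc j))"
    using Suc.prems(2,3) Suc.IH Suc.prems(1)
    by (intro up_to_op[of And] equivT_And equivT_And_commute pull_And) (auto dest: up_to_wf)
  moreover have "Or \<phi> \<psi> \<in> up_to (prenex a (Suc j))"
    using Suc.prems(2,3) Suc.IH Suc.prems(1) dec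
    by (intro up_to_op[of Or] equivT_Or equivT_Or_commute pull_Or) auto
  ultimately show ?case ..
qed

text \<open>Implication becomes a disjunction with a negated antecedent. A quantifier of the right
  sign joins the outer block; one of the wrong sign forces shorter paths, leaving a level for a
  dummy block in front.\<close>

lemma paths_below_up_to:
  "wf_fm \<phi> \<Longrightarrow> j \<le> k \<Longrightarrow> paths_below j a \<phi> \<Longrightarrow> \<phi> \<in> up_to (prenex a j)"
proof (induction \<phi> arbitrary: j a)
  case (And \<phi> \<psi>)
  then show ?case using up_to_And_Or by (auto simp: paths_below_Bool)
next
  case (Or \<phi> \<psi>)
  then show ?case using up_to_And_Or by (auto simp: paths_below_Bool)
next
  case (Imp \<phi> \<psi>)
  then have *: "\<phi> \<in> up_to (prenex (opposite a) j)" "\<psi> \<in> up_to (prenex a j)"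
    by (auto simp: paths_below_Bool)
  then have "decT \<phi>" "Neg \<phi> \<in> up_to (prenex a j)"
    using up_to_Neg_decT[OF Imp.prems(2) *(1)] by auto
  then show ?case
    using * up_to_And_Or[OF Imp.prems(2), of "Neg \<phi>" a \<psi>] Imp.prems(1)
    by (auto intro: up_to_equivT[OF equivT_Imp_Or])
next
  case (All \<phi>)
  \<comment> \<open>\<open>i\<close> is positive by \<open>paths_below_quant\<close>, so the
    quantifier can be absorbed at level \<open>Suc (i - 1)\<close>.\<close>
  have main: "All \<phi> \<in> up_to (prenex Minus i)" if "\<forall>s \<in> Alt (All \<phi>). length s \<le> i" "i \<le> k" for i
    using paths_below_quant[of Minus \<phi> i] that All.IH[of i Minus] All.prems(1)
      up_to_quant[of \<phi> Minus "i - 1"] by simp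
  show ?case
  proof (cases a)
    case Plus
    then obtain i where "j = Suc i" "\<forall>s \<in> Alt (All \<phi>). length s \<le> i"
      using paths_below_quant_opposite[of j Minus \<phi>] All.prems by auto
    then show ?thesis using main[of i] up_to_opposite_Suc[of "All \<phi>" a i] Plus All.prems by simp
  next
    case Minus
    have "\<forall>s \<in> Alt (All \<phi>). length s \<le> j" using All.prems(3) by (rule paths_below_length)
    then show ?thesis using main Minus All.prems by simp
  qed
next
  case (Ex \<phi>)
  have main: "Ex \<phi> \<in> up_to (prenex Plus i)" if "\<forall>s \<in> Alt (Ex \<phi>). length s \<le> i" "i \<le> k" for i
    using paths_below_quant[of Plus \<phi> i] that Ex.IH[of i Plus] Ex.prems(1)
      up_to_quant[of \<phi> Plus "i - 1"] by simp
  show ?case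
  proof (cases a)
    case Minus
    then obtain i where "j = Suc i" "\<forall>s \<in> Alt (Ex \<phi>). length s \<le> i"
      using paths_below_quant_opposite[of j Plus \<phi>] Ex.prems by auto
    then show ?thesis using main[of i] up_to_opposite_Suc[of "Ex \<phi>" a i] Minus Ex.prems by simp
  next
    case Plus
    have "\<forall>s \<in> Alt (Ex \<phi>). length s \<le> j" using Ex.prems(3) by (rule paths_below_length)
    then show ?thesis using main Plus Ex.prems by simp
  qed
qed (auto intro!: qfree_up_to)

text \<open>A degree bound alone does not determine a sign, but an outermost quantifier
  does.\<close>

lemma quant_F_plus:
  assumes "wf_fm \<phi>" and "quant a \<phi> \<in> F_plus k"
  shows "k > 0" and "\<phi> \<in> up_to (prenex a k)" and "quant a \<phi> \<in> up_to (prenex a k)"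
  using paths_below_quant[of a \<phi> k] assms paths_below_up_to[of _ k a] by (auto simp: F_plus_iff)

lemma F_plus_subformula:
  "And \<phi> \<psi> \<in> F_plus k \<Longrightarrow> \<phi> \<in> F_plus k \<and> \<psi> \<in> F_plus k"
  "Or \<phi> \<psi> \<in> F_plus k \<Longrightarrow> \<phi> \<in> F_plus k \<and> \<psi> \<in> F_plus k"
  "Imp \<phi> \<psi> \<in> F_plus k \<Longrightarrow> \<phi> \<in> F_plus k \<and> \<psi> \<in> F_plus k"
  "quant a \<phi> \<in> F_plus k \<Longrightarrow> \<phi> \<in> F_plus k"
  unfolding F_plus_iff Alt_Bool using paths_below_quant[of a \<phi> k]
  by (auto simp: ball_Un paths_below_def)

text \<open>A formula of degree at most \<open>k\<close> may mix Sigma and Pi parts and need not fit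
  one prenex class of level \<open>k\<close>. Connectives are therefore decided componentwise, and
  only quantified subformulas are put in prenex form.\<close>

lemma decT_F_plus: "wf_fm \<phi> \<Longrightarrow> \<phi> \<in> F_plus k \<Longrightarrow> decT \<phi>"
proof (induction \<phi>)
  case (And \<phi> \<psi>)
  then show ?case by (auto dest: F_plus_subformula intro: decT_And)
next
  case (Or \<phi> \<psi>)
  then show ?case by (auto dest: F_plus_subformula intro: decT_Or)
next
  case (Imp \<phi> \<psi>)
  then show ?case by (auto dest: F_plus_subformula intro: decT_Imp)
next
  case (All \<phi>)
  then show ?case using quant_F_plus(3)[of \<phi> Minus] up_to_Neg_decT[of k _ Minus] by auto
next
  case (Ex \<phi>)
  then show ?case using quant_F_plus(3)[of \<phi> Plus] up_to_Neg_decT[of k _ Plus] by auto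
qed (use decT_Sigma[OF qfree_up_to, of _ 0] in auto)

end

section \<open>The translation on the classes R, J and Q\<close>

lemma Alt_subst [simp]: "Alt (subst \<sigma> \<phi>) = Alt \<phi>"
  by (induction \<phi> arbitrary: \<sigma>) auto

lemma F_plus_subst: "\<phi> \<in> F_plus k \<Longrightarrow> subst \<sigma> \<phi> \<in> F_plus k"
  by (simp add: F_plus_iff)

lemma in_R_J_subst:
  "in_R n \<phi> \<Longrightarrow> in_R n (subst \<sigma> \<phi>)"
  "in_J n \<phi> \<Longrightarrow> in_J n (subst \<sigma> \<phi>)"
  by (induction arbitrary: \<sigma> and \<sigma> rule: in_R_in_J.inducts)
    (auto intro: in_R_in_J.intros F_plus_subst)

lemma in_Q_subst: "in_Q n \<phi> \<Longrightarrow> in_Q n (subst \<sigma> \<phi>)"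
proof (induction arbitrary: \<sigma> rule: in_Q.induct)
  case (Q_prime \<phi> k)
  then show ?case by (cases \<phi>) (auto intro: in_Q.Q_prime)
qed (auto intro: in_Q.intros in_R_J_subst)

section \<open>Formulas of degree at most k under the translation\<close>

context semiclassical
begin

lemma cut_mono: "insert \<phi> \<Gamma> \<tturnstile> \<chi> \<Longrightarrow> \<Gamma> \<subseteq> \<Delta> \<Longrightarrow> \<Delta> \<tturnstile> \<phi> \<Longrightarrow> \<Delta> \<tturnstile> \<chi>"
  by (erule cut, erule derives_mono) blast

lemma dnegE: "\<Gamma> \<tturnstile> dneg \<chi> \<phi> \<Longrightarrow> insert \<phi> \<Gamma> \<tturnstile> \<chi> \<Longrightarrow> \<Gamma> \<tturnstile> \<chi>"
  using derives_wf[of T \<Gamma> "dneg \<chi> \<phi>"] unfolding dneg_def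
  by (auto elim!: derives.ImpE intro!: derives.ImpI)

lemma NegE: "\<Gamma> \<tturnstile> Neg \<phi> \<Longrightarrow> \<Gamma> \<tturnstile> \<phi> \<Longrightarrow> wf_fm \<chi> \<Longrightarrow> \<Gamma> \<tturnstile> \<chi>"
  by (rule derives.BotE[OF derives.ImpE])

text \<open>As \<open>\<phi>\<close> is decidable, this says that \<^term>\<open>ntrans \<chi> \<phi>\<close> is equivalent to \<^term>\<open>Or \<phi> \<chi>\<close>.\<close>

lemma F_plus_ntrans:
  assumes "wf_fm \<phi>" and "\<phi> \<in> F_plus k" and "wf_fm \<chi>"
  shows "(\<Gamma> \<tturnstile> ntrans \<chi> \<phi> \<longrightarrow> \<Gamma> \<tturnstile> Neg \<phi> \<longrightarrow> \<Gamma> \<tturnstile> \<chi>) \<and> (\<Gamma> \<tturnstile> \<phi> \<longrightarrow> \<Gamma> \<tturnstile> ntrans \<chi> \<phi>)"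
  using assms
proof (induction \<phi> arbitrary: \<chi> \<Gamma>)
  case (Eq s t)
  have "\<Gamma> \<tturnstile> \<chi>" if "\<Gamma> \<tturnstile> dneg \<chi> (Eq s t)" "\<Gamma> \<tturnstile> Neg (Eq s t)"
    by (rule dnegE[OF that(1)], rule NegE[OF weaken[OF that(2)] hyp_insert]) (use Eq in auto)
  then show ?case using Eq by (auto intro: dnegI)
next
  case Bot
  then show ?case by (auto intro: derives.BotE)
next
  case (And \<phi> \<psi>)
  have wf: "wf_fm \<phi>" "wf_fm \<psi>" "wf_fm \<chi>" and F: "\<phi> \<in> F_plus k" "\<psi> \<in> F_plus k"
    using And.prems F_plus_subformula(1)[of \<phi> \<psi>] by simp_all
  note IH1 = And.IH(1)[OF wf(1) F(1) wf(3)] and IH2 = And.IH(2)[OF wf(2) F(2) wf(3)]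
  show ?case
  proof (intro conjI impI)
    assume t: "\<Gamma> \<tturnstile> ntrans \<chi> (And \<phi> \<psi>)" and n: "\<Gamma> \<tturnstile> Neg (And \<phi> \<psi>)"
    then have t': "\<Gamma> \<tturnstile> ntrans \<chi> \<phi>" "\<Gamma> \<tturnstile> ntrans \<chi> \<psi>"
      by (auto dest: derives.AndE1 derives.AndE2)
    \<comment> \<open>Deciding \<open>\<phi>\<close> and then \<open>\<psi>\<close> finds a false
      conjunct, whose translation yields \<open>\<chi>\<close>; if both hold, \<open>n\<close> is
      contradicted.\<close>
    show "\<Gamma> \<tturnstile> \<chi>"
    proof (rule decT_cases[OF decT_F_plus[OF wf(1) F(1)]])
      show "insert (Neg \<phi>) \<Gamma> \<tturnstile> \<chi>"
        using IH1[of "insert (Neg \<phi>) \<Gamma>"] weaken[OF t'(1)] wf by (auto intro: hyp_insert)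
      show "insert \<phi> \<Gamma> \<tturnstile> \<chi>"
      proof (rule decT_cases[OF decT_F_plus[OF wf(2) F(2)]])
        show "insert (Neg \<psi>) (insert \<phi> \<Gamma>) \<tturnstile> \<chi>"
          using IH2[of "insert (Neg \<psi>) (insert \<phi> \<Gamma>)"] weaken[OF weaken[OF t'(2)]] wf by (auto intro: hyp_insert)
        have "insert \<psi> (insert \<phi> \<Gamma>) \<tturnstile> And \<phi> \<psi>"
          using wf by (intro derives.AndI) (auto intro: derives.hyp)
        with wf show "insert \<psi> (insert \<phi> \<Gamma>) \<tturnstile> \<chi>"
          by (rule_tac NegE[OF weaken[OF weaken[OF n]]])
      qed
    qed
  next
    assume "\<Gamma> \<tturnstile> And \<phi> \<psi>"
    then have "\<Gamma> \<tturnstile> \<phi>" "\<Gamma> \<tturnstile> \<psi>" by (rule derives.AndE1, rule derives.AndE2)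
    then show "\<Gamma> \<tturnstile> ntrans \<chi> (And \<phi> \<psi>)" using IH1 IH2 by (auto intro: derives.AndI)
  qed
next
  case (Or \<phi> \<psi>)
  have wf: "wf_fm \<phi>" "wf_fm \<psi>" "wf_fm \<chi>" and F: "\<phi> \<in> F_plus k" "\<psi> \<in> F_plus k"
    using Or.prems F_plus_subformula(2)[of \<phi> \<psi>] by simp_all
  note IH1 = Or.IH(1)[OF wf(1) F(1) wf(3)] and IH2 = Or.IH(2)[OF wf(2) F(2) wf(3)]
  show ?case
  proof (intro conjI impI)
    assume t: "\<Gamma> \<tturnstile> ntrans \<chi> (Or \<phi> \<psi>)" and n: "\<Gamma> \<tturnstile> Neg (Or \<phi> \<psi>)"
    have "\<Gamma> \<tturnstile> Neg \<phi>"
      by (rule derives.ImpI[OF NegE[OF weaken[OF n] derives.OrI1[OF hyp_insert]]]) (use wf in auto)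
    moreover have "\<Gamma> \<tturnstile> Neg \<psi>"
      by (rule derives.ImpI[OF NegE[OF weaken[OF n] derives.OrI2[OF hyp_insert]]]) (use wf in auto)
    ultimately have 1: "insert (ntrans \<chi> \<phi>) \<Gamma> \<tturnstile> \<chi>" and 2: "insert (ntrans \<chi> \<psi>) \<Gamma> \<tturnstile> \<chi>"
      using wf IH1[of "insert (ntrans \<chi> \<phi>) \<Gamma>"] IH2[of "insert (ntrans \<chi> \<psi>) \<Gamma>"]
      by (auto intro: hyp_insert weaken)
    show "\<Gamma> \<tturnstile> \<chi>"
    proof (rule dnegE[OF t[unfolded ntrans.simps]], rule OrL[OF insertI1])
      show "insert (ntrans \<chi> \<phi>) (insert (Or (ntrans \<chi> \<phi>) (ntrans \<chi> \<psi>)) \<Gamma>) \<tturnstile> \<chi>" by (rule derives_mono[OF 1]) auto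
      show "insert (ntrans \<chi> \<psi>) (insert (Or (ntrans \<chi> \<phi>) (ntrans \<chi> \<psi>)) \<Gamma>) \<tturnstile> \<chi>" by (rule derives_mono[OF 2]) auto
    qed (use wf in auto)
  next
    assume "\<Gamma> \<tturnstile> Or \<phi> \<psi>"
    moreover have "insert \<phi> \<Gamma> \<tturnstile> Or (ntrans \<chi> \<phi>) (ntrans \<chi> \<psi>)"
      using IH1 wf by (intro derives.OrI1) (auto intro: hyp_insert)
    moreover have "insert \<psi> \<Gamma> \<tturnstile> Or (ntrans \<chi> \<phi>) (ntrans \<chi> \<psi>)"
      using IH2 wf by (intro derives.OrI2) (auto intro: hyp_insert)
    ultimately have "\<Gamma> \<tturnstile> Or (ntrans \<chi> \<phi>) (ntrans \<chi> \<psi>)" by (rule derives.OrE)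
    then show "\<Gamma> \<tturnstile> ntrans \<chi> (Or \<phi> \<psi>)" using wf by (auto intro: dnegI)
  qed
next
  case (Imp \<phi> \<psi>)
  have wf: "wf_fm \<phi>" "wf_fm \<psi>" "wf_fm \<chi>" and F: "\<phi> \<in> F_plus k" "\<psi> \<in> F_plus k"
    using Imp.prems F_plus_subformula(3)[of \<phi> \<psi>] by simp_all
  note IH1 = Imp.IH(1)[OF wf(1) F(1) wf(3)] and IH2 = Imp.IH(2)[OF wf(2) F(2) wf(3)]
  note dec = decT_F_plus[OF wf(1) F(1)]
  show ?case
  proof (intro conjI impI)
    assume t: "\<Gamma> \<tturnstile> ntrans \<chi> (Imp \<phi> \<psi>)" and n: "\<Gamma> \<tturnstile> Neg (Imp \<phi> \<psi>)"
    show "\<Gamma> \<tturnstile> \<chi>"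
    proof (rule decT_cases[OF dec])
      have "insert \<phi> \<Gamma> \<tturnstile> ntrans \<chi> \<phi>" using IH1 wf by (auto intro: hyp_insert)
      then have "insert \<phi> \<Gamma> \<tturnstile> ntrans \<chi> \<psi>"
        using t by (auto intro: derives.ImpE[OF weaken])
      moreover have "insert \<psi> (insert \<phi> \<Gamma>) \<tturnstile> Imp \<phi> \<psi>"
        using wf by (intro derives.ImpI) (auto intro: derives.hyp)
      then have "insert \<phi> \<Gamma> \<tturnstile> Neg \<psi>"
        using wf by (rule_tac derives.ImpI[OF NegE[OF weaken[OF weaken[OF n]]]]) auto
      ultimately show "insert \<phi> \<Gamma> \<tturnstile> \<chi>" using IH2 by blast
      have "insert (Neg \<phi>) \<Gamma> \<tturnstile> Imp \<phi> \<psi>"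
        using wf by (intro derives.ImpI NegL[of \<phi> _ \<psi>] derives.hyp) auto
      then show "insert (Neg \<phi>) \<Gamma> \<tturnstile> \<chi>"
        using wf by (rule_tac NegE[OF weaken[OF n]])
    qed
  next
    assume i: "\<Gamma> \<tturnstile> Imp \<phi> \<psi>"
    let ?G = "insert (ntrans \<chi> \<phi>) \<Gamma>"
    have "?G \<tturnstile> ntrans \<chi> \<psi>"
    proof (rule decT_cases[OF dec])
      have "insert \<phi> ?G \<tturnstile> \<psi>"
        by (rule derives.ImpE[OF weaken[OF weaken[OF i]] hyp_insert[OF wf(1)]])
      then show "insert \<phi> ?G \<tturnstile> ntrans \<chi> \<psi>" using IH2 by blast
      \<comment> \<open>A false antecedent with a derivable translation gives \<open>\<chi>\<close>,
        which implies every translation.\<close>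
      have "insert (Neg \<phi>) ?G \<tturnstile> \<chi>"
        using IH1[of "insert (Neg \<phi>) ?G"] wf by (auto intro: derives.hyp)
      then show "insert (Neg \<phi>) ?G \<tturnstile> ntrans \<chi> \<psi>"
        using wf by (intro ntrans_from_target)
    qed
    then show "\<Gamma> \<tturnstile> ntrans \<chi> (Imp \<phi> \<psi>)" using wf by (auto intro: derives.ImpI)
  qed
next
  case (All \<phi>)
  have wf: "wf_fm \<phi>" "wf_fm (lift \<chi>)" and F: "\<phi> \<in> F_plus k"
    using All.prems F_plus_subformula(4)[of Minus \<phi>] by simp_all
  note IH = All.IH[OF wf(1) F wf(2)]
  have dec: "decT \<phi>" using wf F decT_F_plus by blast
  from All.prems quant_F_plus[of \<phi> Minus] have kp: "k > 0" and "\<phi> \<in> up_to (prenex Minus k)" by auto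
  then have "Neg \<phi> \<in> up_to (prenex Plus k)" using up_to_Neg_decT[of k \<phi> Minus] by simp
  \<comment> \<open>\<open>Neg \<phi>\<close> is in the Sigma class of level \<open>k\<close> and
    \<open>k\<close> is positive, so another existential quantifier stays at level \<open>k\<close>.
    Hence a refuted universal formula has a counterexample.\<close>
  then have "decT (Ex (Neg \<phi>))"
    using up_to_quant[of "Neg \<phi>" Plus "k - 1"] kp decT_Sigma[of _ k] by simp
  note eq = Neg_All[OF dec this]
  show ?case
  proof (intro conjI impI)
    assume t: "\<Gamma> \<tturnstile> ntrans \<chi> (All \<phi>)" and n: "\<Gamma> \<tturnstile> Neg (All \<phi>)"
    have "insert (Neg \<phi>) (lift ` \<Gamma>) \<tturnstile> ntrans (lift \<chi>) \<phi>"
      using t unfolding ntrans.simps by (rule weaken[OF AllE_lift[OF lift_entails]])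
    then have "insert (Neg \<phi>) (lift ` \<Gamma>) \<tturnstile> lift \<chi>"
      using IH[of "insert (Neg \<phi>) (lift ` \<Gamma>)"] wf by (auto intro: hyp_insert)
    then show "\<Gamma> \<tturnstile> \<chi>" by (rule derives.ExE[OF equivTD1[OF eq n]])
  next
    assume "\<Gamma> \<tturnstile> All \<phi>"
    then have "lift ` \<Gamma> \<tturnstile> \<phi>" by (rule AllE_lift[OF lift_entails])
    then show "\<Gamma> \<tturnstile> ntrans \<chi> (All \<phi>)" using IH by (auto intro: derives.AllI)
  qed
next
  case (Ex \<phi>)
  have wf: "wf_fm \<phi>" "wf_fm \<chi>" "wf_fm (lift \<chi>)" and F: "\<phi> \<in> F_plus k"
    using Ex.prems F_plus_subformula(4)[of Plus \<phi>] by simp_all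
  note IH = Ex.IH[OF wf(1) F wf(3)]
  show ?case
  proof (intro conjI impI)
    assume t: "\<Gamma> \<tturnstile> ntrans \<chi> (Ex \<phi>)" and n: "\<Gamma> \<tturnstile> Neg (Ex \<phi>)"
    show "\<Gamma> \<tturnstile> \<chi>"
    proof (rule dnegE[OF t[unfolded ntrans.simps]], rule ExL[OF insertI1])
      let ?G = "insert (ntrans (lift \<chi>) \<phi>) (lift ` insert (Ex (ntrans (lift \<chi>) \<phi>)) \<Gamma>)"
      have "?G \<tturnstile> Neg (lift (Ex \<phi>))"
        using weaken[OF lift_entails[OF weaken[OF n]]] by simp
      then have "?G \<tturnstile> Neg \<phi>"
        using wf by (rule_tac derives.ImpI[OF NegE[OF weaken ExI_lift[OF hyp_insert]]]) auto
      then show "?G \<tturnstile> lift \<chi>" using IH[of ?G] wf by (auto intro: hyp_insert)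
    qed (use wf in auto)
  next
    assume e: "\<Gamma> \<tturnstile> Ex \<phi>"
    have "insert \<phi> (lift ` \<Gamma>) \<tturnstile> ntrans (lift \<chi>) \<phi>" using IH wf by (auto intro: hyp_insert)
    then have "\<Gamma> \<tturnstile> Ex (ntrans (lift \<chi>) \<phi>)" by (rule derives.ExE[OF e ExI_lift])
    then show "\<Gamma> \<tturnstile> ntrans \<chi> (Ex \<phi>)" using wf by (auto intro: dnegI)
  qed
qed

section \<open>The classes R and J\<close>

lemma F_plus_ntrans_R:
  assumes "wf_fm \<phi>" and "\<phi> \<in> F_plus k" and "insert (Neg \<phi>) \<Gamma> \<tturnstile> \<chi>"
  shows "\<Gamma> \<tturnstile> ntrans \<chi> \<phi>"
proof (rule decT_cases[OF decT_F_plus[OF assms(1,2)]])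
  have "wf_fm \<chi>" using assms(3) by (rule derives_wf)
  then show "insert \<phi> \<Gamma> \<tturnstile> ntrans \<chi> \<phi>" using F_plus_ntrans[OF assms(1,2)] hyp_insert[OF assms(1)] by blast
  show "insert (Neg \<phi>) \<Gamma> \<tturnstile> ntrans \<chi> \<phi>" using assms by (intro ntrans_from_target)
qed

lemma F_plus_ntrans_J:
  assumes "wf_fm \<phi>" and "\<phi> \<in> F_plus k" and "wf_fm \<chi>" and "\<Gamma> \<tturnstile> ntrans \<chi> \<phi>"
  shows "\<Gamma> \<tturnstile> dneg \<chi> \<phi>"
proof (rule decT_cases[OF decT_F_plus[OF assms(1,2)]])
  show "insert \<phi> \<Gamma> \<tturnstile> dneg \<chi> \<phi>" using assms by (intro dnegI hyp_insert)
  have "insert (Neg \<phi>) \<Gamma> \<tturnstile> \<chi>"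
    using F_plus_ntrans[OF assms(1,2,3), of "insert (Neg \<phi>) \<Gamma>"] weaken[OF assms(4)] assms(1)
      hyp_insert[of "Neg \<phi>" \<Gamma>] by simp
  then show "insert (Neg \<phi>) \<Gamma> \<tturnstile> dneg \<chi> \<phi>" using assms by (intro dneg_from_target)
qed

text \<open>The halves are proved simultaneously because implication places a formula of one class
  to the left of one of the other. The R half starts from a refutation leading to
  \<open>\<chi>\<close>, a form that passes universal quantifiers since refuting an instance refutes
  the whole; the J half ends in a \<open>dneg\<close>, which passes existential ones.\<close>

lemma ntrans_R_J:
  "in_R n \<phi> \<Longrightarrow> n = Suc k \<Longrightarrow> wf_fm \<phi> \<Longrightarrow> insert (Neg \<phi>) \<Gamma> \<tturnstile> \<chi> \<Longrightarrow> \<Gamma> \<tturnstile> ntrans \<chi> \<phi>"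
  "in_J n \<phi> \<Longrightarrow> n = Suc k \<Longrightarrow> wf_fm \<phi> \<Longrightarrow> wf_fm \<chi> \<Longrightarrow> \<Gamma> \<tturnstile> ntrans \<chi> \<phi> \<Longrightarrow> \<Gamma> \<tturnstile> dneg \<chi> \<phi>"
proof (induction arbitrary: \<Gamma> \<chi> and \<Gamma> \<chi> rule: in_R_in_J.inducts)
  case (R_F \<phi> k')
  then show ?case using F_plus_ntrans_R by blast
next
  case (J_F \<phi> k')
  then show ?case using F_plus_ntrans_J by blast
next
  case (R_And k' \<phi> \<psi>)
  then have wf: "wf_fm \<phi>" "wf_fm \<psi>" by auto
  have h: "insert (And \<phi> \<psi>) \<Delta> \<tturnstile> \<phi>" "insert (And \<phi> \<psi>) \<Delta> \<tturnstile> \<psi>" for \<Delta>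
    using wf derives.AndE1[OF hyp_insert] derives.AndE2[OF hyp_insert] by auto
  have "insert (Neg \<phi>) \<Gamma> \<tturnstile> Neg (And \<phi> \<psi>)"
    using wf by (intro derives.ImpI NegL[OF _ _ h(1)]) auto
  then have "insert (Neg \<phi>) \<Gamma> \<tturnstile> \<chi>" by (rule cut_mono[OF R_And.prems(3), rotated]) auto
  moreover have "insert (Neg \<psi>) \<Gamma> \<tturnstile> Neg (And \<phi> \<psi>)"
    using wf by (intro derives.ImpI NegL[OF _ _ h(2)]) auto
  then have "insert (Neg \<psi>) \<Gamma> \<tturnstile> \<chi>" by (rule cut_mono[OF R_And.prems(3), rotated]) auto
  ultimately show ?case using R_And.IH R_And.prems(1) wf by (auto intro!: derives.AndI)
next
  case (R_Or k' \<phi> \<psi>)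
  then have wf: "wf_fm \<phi>" "wf_fm \<psi>" "wf_fm \<chi>" using derives_wf by auto
  let ?H = "Imp (Or (ntrans \<chi> \<phi>) (ntrans \<chi> \<psi>)) \<chi>"
  let ?G = "insert ?H \<Gamma>"
  \<comment> \<open>The two induction hypotheses are nested: refuting both disjuncts gives
    \<open>\<chi>\<close>, hence the translation of \<open>\<psi>\<close> under
    \<open>Neg \<phi>\<close>; then \<open>?H\<close> gives \<open>\<chi>\<close> again, hence the
    translation of \<open>\<phi>\<close>.\<close>
  have "insert (Neg \<psi>) (insert (Neg \<phi>) ?G) \<tturnstile> Neg (Or \<phi> \<psi>)"
  proof (rule derives.ImpI, rule OrL[OF insertI1])
    show "insert \<phi> (insert (Or \<phi> \<psi>) (insert (Neg \<psi>) (insert (Neg \<phi>) ?G))) \<tturnstile> Bot"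
      by (rule NegL[of \<phi>]) (use wf in \<open>auto intro: hyp_insert\<close>)
    show "insert \<psi> (insert (Or \<phi> \<psi>) (insert (Neg \<psi>) (insert (Neg \<phi>) ?G))) \<tturnstile> Bot"
      by (rule NegL[of \<psi>]) (use wf in \<open>auto intro: hyp_insert\<close>)
  qed (use wf in auto)
  then have "insert (Neg \<psi>) (insert (Neg \<phi>) ?G) \<tturnstile> \<chi>"
    by (rule cut_mono[OF R_Or.prems(3), rotated]) auto
  then have "insert (Neg \<phi>) ?G \<tturnstile> ntrans \<chi> \<psi>"
    using R_Or.IH(2) R_Or.prems wf by blast
  then have "insert (Neg \<phi>) ?G \<tturnstile> \<chi>"
    using wf by (rule_tac ImpL[of "Or (ntrans \<chi> \<phi>) (ntrans \<chi> \<psi>)"]) (auto intro: derives.OrI2)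
  then have "?G \<tturnstile> ntrans \<chi> \<phi>" using R_Or.IH(1) R_Or.prems wf by blast
  then have "?G \<tturnstile> \<chi>"
    using wf by (rule_tac ImpL[of "Or (ntrans \<chi> \<phi>) (ntrans \<chi> \<psi>)"]) (auto intro: derives.OrI1)
  then show ?case using wf by (auto simp: dneg_def intro: derives.ImpI)
next
  case (R_All k' \<phi>)
  then have wf: "wf_fm \<phi>" by simp
  have "insert (Neg \<phi>) (lift ` \<Gamma>) \<tturnstile> lift (Neg (All \<phi>))"
    unfolding lift_simps using wf
    by (intro derives.ImpI NegL[OF _ _ AllL'[of \<phi>]]) auto
  then have "insert (Neg \<phi>) (lift ` \<Gamma>) \<tturnstile> lift \<chi>"
    by (rule cut_mono[OF lift_entails[OF R_All.prems(3), unfolded image_insert], rotated]) auto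
  then show ?case using R_All.IH R_All.prems(1) wf by (auto intro!: derives.AllI)
next
  case (R_Imp k' \<phi> \<psi>)
  then have wf: "wf_fm \<phi>" "wf_fm \<psi>" "wf_fm \<chi>" using derives_wf by auto
  let ?G = "insert (ntrans \<chi> \<phi>) \<Gamma>"
  have "insert (Imp \<phi> \<psi>) (insert (Neg \<psi>) (insert \<phi> ?G)) \<tturnstile> \<psi>"
    using wf by (rule_tac ImpL[of \<phi>]) (auto intro: derives.hyp)
  then have "insert (Neg \<psi>) (insert \<phi> ?G) \<tturnstile> Neg (Imp \<phi> \<psi>)"
    using wf by (intro derives.ImpI NegL[of \<psi> _ Bot]) auto
  then have "insert (Neg \<psi>) (insert \<phi> ?G) \<tturnstile> \<chi>"
    by (rule cut_mono[OF R_Imp.prems(3), rotated]) auto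
  then have "insert \<phi> ?G \<tturnstile> ntrans \<chi> \<psi>" using R_Imp.IH(2) R_Imp.prems(1) wf by blast
  \<comment> \<open>The J half yields \<open>\<phi>\<close> only under \<open>dneg\<close>, which is
    enough because the goal is a translation.\<close>
  moreover have "?G \<tturnstile> dneg \<chi> \<phi>"
    using wf by (intro R_Imp.IH(1) R_Imp.prems(1) hyp_insert) simp_all
  ultimately have "?G \<tturnstile> ntrans \<chi> \<psi>" by (rule ntrans_bind[rotated])
  then show ?case using wf by (auto intro: derives.ImpI)
next
  case (J_And k' \<phi> \<psi>)
  then have wf: "wf_fm \<phi>" "wf_fm \<psi>" by auto
  have t: "\<Gamma> \<tturnstile> ntrans \<chi> \<phi>" "\<Gamma> \<tturnstile> ntrans \<chi> \<psi>"
    using J_And.prems(4) unfolding ntrans.simps by (rule derives.AndE1, rule derives.AndE2)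
  have d: "\<Gamma> \<tturnstile> dneg \<chi> \<phi>" "\<Gamma> \<tturnstile> dneg \<chi> \<psi>"
    using J_And.IH t J_And.prems wf by auto
  have "insert \<psi> (insert \<phi> \<Gamma>) \<tturnstile> dneg \<chi> (And \<phi> \<psi>)"
    using wf J_And.prems by (intro dnegI derives.AndI) (auto intro: derives.hyp)
  then show ?case by (rule dneg_bind[OF d(1) dneg_bind[OF weaken[OF d(2)]]])
next
  case (J_Or k' \<phi> \<psi>)
  then have wf: "wf_fm \<phi>" "wf_fm \<psi>" "wf_fm \<chi>" by auto
  let ?D = "Or (ntrans \<chi> \<phi>) (ntrans \<chi> \<psi>)"
  have "insert ?D \<Gamma> \<tturnstile> dneg \<chi> (Or \<phi> \<psi>)"
  proof (rule OrL[OF insertI1])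
    have "insert (ntrans \<chi> \<phi>) (insert ?D \<Gamma>) \<tturnstile> dneg \<chi> \<phi>"
      using wf by (intro J_Or.IH(1) J_Or.prems(1) hyp_insert) simp_all
    then show "insert (ntrans \<chi> \<phi>) (insert ?D \<Gamma>) \<tturnstile> dneg \<chi> (Or \<phi> \<psi>)"
      using wf by (rule_tac dneg_bind[OF _ dnegI[OF derives.OrI1[OF hyp_insert]]])
    have "insert (ntrans \<chi> \<psi>) (insert ?D \<Gamma>) \<tturnstile> dneg \<chi> \<psi>"
      using wf by (intro J_Or.IH(2) J_Or.prems(1) hyp_insert) simp_all
    then show "insert (ntrans \<chi> \<psi>) (insert ?D \<Gamma>) \<tturnstile> dneg \<chi> (Or \<phi> \<psi>)"
      using wf by (rule_tac dneg_bind[OF _ dnegI[OF derives.OrI2[OF hyp_insert]]])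
  qed (use wf in auto)
  then show ?case using J_Or.prems(4) by (rule_tac dneg_bind) simp_all
next
  case (J_Ex k' \<phi>)
  then have wf: "wf_fm \<phi>" "wf_fm \<chi>" by auto
  let ?D = "Ex (ntrans (lift \<chi>) \<phi>)"
  have "insert ?D \<Gamma> \<tturnstile> dneg \<chi> (Ex \<phi>)"
  proof (rule ExL[OF insertI1])
    let ?G = "insert (ntrans (lift \<chi>) \<phi>) (lift ` insert ?D \<Gamma>)"
    have "?G \<tturnstile> dneg (lift \<chi>) \<phi>"
      using wf by (intro J_Ex.IH J_Ex.prems(1) hyp_insert) simp_all
    moreover have "insert \<phi> ?G \<tturnstile> dneg (lift \<chi>) (lift (Ex \<phi>))"
      using wf by (intro dnegI ExI_lift hyp_insert) auto
    ultimately show "?G \<tturnstile> lift (dneg \<chi> (Ex \<phi>))"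
      unfolding lift_dneg by (rule dneg_bind)
  qed (use wf in auto)
  then show ?case using J_Ex.prems(4) by (rule_tac dneg_bind) simp_all
next
  case (J_Imp k' \<phi> \<psi>)
  then have wf: "wf_fm \<phi>" "wf_fm \<psi>" "wf_fm \<chi>" by auto
  let ?G = "insert (Imp (Imp \<phi> \<psi>) \<chi>) \<Gamma>"
  \<comment> \<open>The assumption that the implication leads to \<open>\<chi>\<close> is used
    twice: with a false antecedent, to meet the premise of the R half, and with a true consequent,
    to discharge the resulting \<open>dneg\<close>.\<close>
  have "insert (Neg \<phi>) ?G \<tturnstile> Imp \<phi> \<psi>"
    using wf by (intro derives.ImpI NegL[of \<phi> _ \<psi>] derives.hyp) auto
  then have "insert (Neg \<phi>) ?G \<tturnstile> \<chi>"
    using wf by (rule_tac ImpL[of "Imp \<phi> \<psi>"]) auto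
  then have "?G \<tturnstile> ntrans \<chi> \<phi>" using J_Imp.IH(1) J_Imp.prems(1) wf by blast
  then have "?G \<tturnstile> ntrans \<chi> \<psi>"
    using J_Imp.prems(4) by (rule_tac derives.ImpE[OF weaken]) simp_all
  then have d: "?G \<tturnstile> dneg \<chi> \<psi>" using J_Imp.IH(2) J_Imp.prems wf by blast
  have "insert \<psi> ?G \<tturnstile> Imp \<phi> \<psi>" using wf by (intro derives.ImpI derives.hyp) auto
  then have "insert \<psi> ?G \<tturnstile> \<chi>" using wf by (rule_tac ImpL[of "Imp \<phi> \<psi>"]) auto
  then have "?G \<tturnstile> \<chi>" by (rule dnegE[OF d])
  then show ?case using wf by (auto simp: dneg_def intro: derives.ImpI)
qed simp_all

text \<open>Translation weakens every positive position. Only the antecedent of an implication must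
  be recovered from its translation; being in J, it is obtained under \<open>dneg\<close>.\<close>

lemma ntrans_Q:
  "in_Q n \<phi> \<Longrightarrow> n = Suc k \<Longrightarrow> wf_fm \<chi> \<Longrightarrow> \<Gamma> \<tturnstile> \<phi> \<Longrightarrow> \<Gamma> \<tturnstile> ntrans \<chi> \<phi>"
proof (induction arbitrary: \<Gamma> \<chi> rule: in_Q.induct)
  case (Q_prime \<phi> k')
  then show ?case by (cases \<phi>) (auto intro: dnegI derives.BotE)
next
  case (Q_And k' \<phi> \<psi>)
  have "\<Gamma> \<tturnstile> \<phi>" "\<Gamma> \<tturnstile> \<psi>" using Q_And.prems(3) by (rule derives.AndE1, rule derives.AndE2)
  then show ?case using Q_And.IH Q_And.prems(1,2) by (auto intro!: derives.AndI)
next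
  case (Q_Or k' \<phi> \<psi>)
  have wf: "wf_fm \<phi>" "wf_fm \<psi>" using derives_wf[OF Q_Or.prems(3)] by auto
  have "insert \<phi> \<Gamma> \<tturnstile> Or (ntrans \<chi> \<phi>) (ntrans \<chi> \<psi>)"
    using Q_Or.IH(1)[OF Q_Or.prems(1,2) hyp_insert[OF wf(1)]] wf Q_Or.prems(2) by (auto intro: derives.OrI1)
  moreover have "insert \<psi> \<Gamma> \<tturnstile> Or (ntrans \<chi> \<phi>) (ntrans \<chi> \<psi>)"
    using Q_Or.IH(2)[OF Q_Or.prems(1,2) hyp_insert[OF wf(2)]] wf Q_Or.prems(2) by (auto intro: derives.OrI2)
  ultimately have "\<Gamma> \<tturnstile> Or (ntrans \<chi> \<phi>) (ntrans \<chi> \<psi>)" by (rule derives.OrE[OF Q_Or.prems(3)])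
  then show ?case using Q_Or.prems by (auto intro: dnegI)
next
  case (Q_All k' \<phi>)
  have "lift ` \<Gamma> \<tturnstile> \<phi>" using Q_All.prems(3) by (rule AllE_lift[OF lift_entails])
  then show ?case using Q_All.IH Q_All.prems(1,2) by (auto intro!: derives.AllI)
next
  case (Q_Ex k' \<phi>)
  have wf: "wf_fm \<phi>" using derives_wf[OF Q_Ex.prems(3)] by auto
  have "insert \<phi> (lift ` \<Gamma>) \<tturnstile> ntrans (lift \<chi>) \<phi>" using Q_Ex.IH[OF Q_Ex.prems(1) _ hyp_insert[OF wf]] Q_Ex.prems(2) by simp
  then have "\<Gamma> \<tturnstile> Ex (ntrans (lift \<chi>) \<phi>)" by (rule derives.ExE[OF Q_Ex.prems(3) ExI_lift])
  then show ?case using Q_Ex.prems by (auto intro: dnegI)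
next
  case (Q_Imp k' \<phi> \<psi>)
  have wf: "wf_fm \<phi>" "wf_fm \<psi>" using derives_wf[OF Q_Imp.prems(3)] by auto
  let ?G = "insert (ntrans \<chi> \<phi>) \<Gamma>"
  have "?G \<tturnstile> dneg \<chi> \<phi>"
    using wf Q_Imp.prems(2) by (intro ntrans_R_J(2)[OF Q_Imp.hyps(1) Q_Imp.prems(1)] hyp_insert) simp_all
  moreover have "insert \<phi> ?G \<tturnstile> \<psi>"
    by (rule derives.ImpE[OF weaken[OF weaken[OF Q_Imp.prems(3)]] hyp_insert[OF wf(1)]])
  then have "insert \<phi> ?G \<tturnstile> ntrans \<chi> \<psi>" using Q_Imp.IH Q_Imp.prems(1,2) by blast
  ultimately have "?G \<tturnstile> ntrans \<chi> \<psi>" by (rule ntrans_bind)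
  then show ?case using wf Q_Imp.prems(2) by (auto intro: derives.ImpI)
qed simp_all

section \<open>Conservation for J and its extension to V\<close>

lemma conservation_J:
  assumes "wf_fm \<phi>" and "wf_fm \<psi>" and "in_J (Suc k) \<phi>" and "in_Q (Suc k) \<psi>"
    and "PA \<turnstile> Imp \<psi> \<phi>"
  shows "{} \<tturnstile> Imp \<psi> \<phi>"
proof (rule derives.ImpI)
  have "{\<psi>} \<tturnstile> ntrans \<phi> \<psi>"
    using assms by (intro ntrans_Q[OF assms(4)] hyp_insert) auto
  moreover have "{} \<tturnstile> Imp (ntrans \<phi> \<psi>) (ntrans \<phi> \<phi>)"
    using ntrans_sound[OF assms(5,1)] by simp
  ultimately have "{\<psi>} \<tturnstile> ntrans \<phi> \<phi>"
    by (rule derives.ImpE[OF weaken, rotated])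
  then have "{\<psi>} \<tturnstile> dneg \<phi> \<phi>"
    by (rule ntrans_R_J(2)[OF assms(3) refl assms(1) assms(1)])
  then show "{\<psi>} \<tturnstile> \<phi>" by (rule dneg_target)
qed (rule assms(2))

text \<open>A classical proof of a conjunction or universal formula is first split into proofs of
  its parts, and the resulting derivations in the base theory are reassembled. \<open>\<psi>\<close>
  is generalised because it is lifted past a universal quantifier.\<close>

lemma conservation_V:
  assumes "in_V n \<phi>" and "n = Suc k" and "wf_fm \<phi>" and "wf_fm \<psi>" and "in_Q n \<psi>"
    and "PA \<turnstile> Imp \<psi> \<phi>"
  shows "{} \<tturnstile> Imp \<psi> \<phi>"
  using assms
proof (induction arbitrary: \<psi> rule: in_V.induct)
  case (V_J k' \<phi>)
  then show ?case using conservation_J by auto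
next
  case (V_And k' \<phi> \<phi>')
  have "derives PA {\<psi>} (And \<phi> \<phi>')"
    by (rule derives.ImpE[OF derives_mono[OF V_And.prems(5)] derives.hyp]) (use V_And.prems in auto)
  then have "PA \<turnstile> Imp \<psi> \<phi>" "PA \<turnstile> Imp \<psi> \<phi>'"
    using V_And.prems by (auto intro: derives.ImpI derives.AndE1 derives.AndE2)
  then have "{} \<tturnstile> Imp \<psi> \<phi>" "{} \<tturnstile> Imp \<psi> \<phi>'"
    using V_And by auto
  then have "{\<psi>} \<tturnstile> \<phi>" "{\<psi>} \<tturnstile> \<phi>'"
    using V_And.prems(3) derives.ImpE[OF weaken hyp_insert] by blast+
  then show ?case using V_And.prems by (auto intro: derives.ImpI derives.AndI)
next
  case (V_All k' \<phi>)
  \<comment> \<open>Opening the quantifier means lifting a derivation in \<open>PA\<close>, so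
    closure is required for these axioms too.\<close>
  have "subst_closed PA"
    unfolding PA_def by (intro subst_closed_Un subst_closed_HA subst_closed_LEM) auto
  then have "PA \<turnstile> lift (Imp \<psi> (All \<phi>))"
    using derives_lift[OF _ V_All.prems(5)] by simp
  then have "derives PA {lift \<psi>} (lift (All \<phi>))"
    unfolding lift_simps
    by (rule derives.ImpE[OF derives_mono derives.hyp]) (use V_All.prems in auto)
  then have "derives PA {lift \<psi>} \<phi>" by (rule AllE_lift)
  then have "PA \<turnstile> Imp (lift \<psi>) \<phi>" using V_All.prems by (auto intro: derives.ImpI)
  moreover have "in_Q (Suc k') (lift \<psi>)"
    using V_All.prems unfolding lift_def by (auto intro: in_Q_subst)
  ultimately have "{} \<tturnstile> Imp (lift \<psi>) \<phi>" using V_All by auto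
  then have "{lift \<psi>} \<tturnstile> \<phi>"
    using V_All.prems(3) derives.ImpE[OF weaken hyp_insert] by (metis wf_lift)
  then show ?case using V_All.prems by (auto intro!: derives.ImpI derives.AllI)
qed

end

theorem theorem3p17:
  fixes k :: nat and \<phi> \<psi> :: fm
  assumes "wf_fm \<phi>" and "wf_fm \<psi>"
    and "in_V (k + 1) \<phi>" and "in_Q (k + 1) \<psi>"
    and "PA \<turnstile> Imp \<psi> \<phi>"
  shows "HA \<union> LEM (Sigma_fm k) \<turnstile> Imp \<psi> \<phi>"
proof -
  interpret semiclassical "HA \<union> LEM (Sigma_fm k)" k
    by standard simp
  show ?thesis
    using conservation_V[OF assms(3) _ assms(1,2,4,5)] by simp
qed

end
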